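(* Let $X$ be a real Banach space, let $T(t)$ be a $C_0$ semigroup on $X$ with generator $A$ (domain $\mathcal{D}_A$), let $V$ be a real Hilbert space and $C\in\mathcal{B}(X,V)$. If the pair $(C,A)$ is exponentially detectable, then the following conditions are equivalent: (i) the equation $A^*P+PA=-C^*C$ has a positive definite solution $P\in\mathcal{B}_s^+(X,X^* )$ such that $P(\mathcal{D}_A)\subseteq\mathcal{D}_{A^*}$; (ii) $T(t)$ is exponentially stable; (iii) the Lyapunov generator $\mathcal{L}_A$ has a bounded inverse on $\mathcal{B}_s(X,X^* )$ and $-(\mathcal{L}_A)^{-1}\ge 0$.
   Context: $\mathcal{B}(X,Y)$ is the Banach space of bounded linear operators $X\to Y$ with the operator norm; $\langle\cdot,\cdot\rangle$ is the duality pairing between $X^*$ and $X$. An operator $P\in\mathcal{B}(X,X^* )$ is symmetric if $\langle Px,y\rangle=\langle Py,x\rangle$ for all $x,y\in X$, and positive definite if $\langle Px,x\rangle\ge 0$ for all $x\in X$ (non-strict inequality). $\mathcal{B}_s(X,X^* )$ is the space of symmetric operators and $\mathcal{B}_s^+(X,X^* )$ the cone of symmetric positive definite ones; $P\ge R$ means $P-R\in\mathcal{B}_s^+(X,X^* )$. A linear map $\mathcal{M}$ on $\mathcal{B}_s(X,X^* )$ satisfies $\mathcal{M}\ge0$ if it maps $\mathcal{B}_s^+(X,X^* )$ into itself. $A^*$ is the Banach space adjoint of $A$ with domain $\mathcal{D}_{A^*}\subseteq X^*$. Hilbert spaces are identified with their duals, so $C^*\in\mathcal{B}(V,X^* )$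 and $C^*C\in\mathcal{B}_s^+(X,X^* )$. The expression $A^*P+PA$, defined on $\mathcal{D}_A$ when $P(\mathcal{D}_A)\subseteq\mathcal{D}_{A^*}$, is identified with its closure, so the equation in (i) means that $A^*Px+PAx=-C^*Cx$ for all $x\in\mathcal{D}_A$. A semigroup $T(t)$ is exponentially stable if $\|T(t)\|\le Me^{-\varepsilon t}$ for all $t\ge0$ and some $M,\varepsilon>0$. The pair $(C,A)$ is exponentially detectable if there exists $L\in\mathcal{B}(V,X)$ such that $A-LC$ generates an exponentially stable $C_0$ semigroup. The Lyapunov semigroup of $T(t)$ is $\mathcal{T}(t)P:=T^*(t)PT(t)$ on $\mathcal{B}_s(X,X^* )$. The Lyapunov generator $\mathcal{L}_A$ is its weak* generator: $\mathcal{L}_AP$ is the weak* limit of $\frac1t(\mathcal{T}(t)P-P)$ as $t\to0^+$, with domain the set of $P$ for which this limit exists. Here the weak* topology is the one from the duality of $\mathcal{B}_s(X,X^* )$ with the closed linear span of the tensors $x\otimes y+y\otimes x$ in the projective tensor product $X\otimes_\pi X$, with pairing determined by $(x\otimes y,P)\mapsto\langle Px,y\rangle$. *)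

theory Defs
  imports "HOL-Analysis.Analysis"
begin

section \<open>Semigroups and generators\<close>

definition C0_semigroup :: "(real \<Rightarrow> 'a::banach \<Rightarrow>\<^sub>L 'a) \<Rightarrow> bool" where
  "C0_semigroup T \<longleftrightarrow>
     T 0 = id_blinfun \<and>
     (\<forall>s\<ge>0. \<forall>t\<ge>0. T (s + t) = T s o\<^sub>L T t) \<and>
     (\<forall>x. ((\<lambda>t. T t x) \<longlongrightarrow> x) (at_right 0))"

text \<open>An unbounded operator is a domain \<open>D\<close> together with a function \<open>A\<close> whose values outside
  \<open>D\<close> are never used. The domain of a generator is exactly the set on which the
  difference quotient converges. A semigroup is only looked at on \<open>[0,\<infinity>)\<close>.\<close>

definition generates :: "'a::banach set \<Rightarrow> ('a \<Rightarrow> 'a) \<Rightarrow> (real \<Rightarrow> 'a \<Rightarrow>\<^sub>L 'a) \<Rightarrow> bool" where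
  "generates D A T \<longleftrightarrow>
     C0_semigroup T \<and>
     D = {x. \<exists>y. ((\<lambda>t. (1 / t) *\<^sub>R (T t x - x)) \<longlongrightarrow> y) (at_right 0)} \<and>
     (\<forall>x\<in>D. ((\<lambda>t. (1 / t) *\<^sub>R (T t x - x)) \<longlongrightarrow> A x) (at_right 0))"

definition exponentially_stable :: "(real \<Rightarrow> 'a::banach \<Rightarrow>\<^sub>L 'a) \<Rightarrow> bool" where
  "exponentially_stable T \<longleftrightarrow>
     (\<exists>M>0. \<exists>\<epsilon>>0. \<forall>t\<ge>0. norm (T t) \<le> M * exp (- \<epsilon> * t))"

definition exponentially_detectable ::
  "('a::banach \<Rightarrow>\<^sub>L 'v::{real_inner,complete_space}) \<Rightarrow> 'a set \<Rightarrow> ('a \<Rightarrow> 'a) \<Rightarrow> bool" where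
  "exponentially_detectable C D A \<longleftrightarrow>
     (\<exists>(L :: 'v \<Rightarrow>\<^sub>L 'a) S. generates D (\<lambda>x. A x - L (C x)) S \<and> exponentially_stable S)"

section \<open>Adjoints\<close>

definition adjoint_domain :: "'a::banach set \<Rightarrow> ('a \<Rightarrow> 'a) \<Rightarrow> ('a \<Rightarrow>\<^sub>L real) set" where
  "adjoint_domain D A = {f :: 'a \<Rightarrow>\<^sub>L real. \<exists>g :: 'a \<Rightarrow>\<^sub>L real. \<forall>x\<in>D. f (A x) = g x}"

text \<open>The functional below is unique because generators are densely defined.\<close>

definition banach_adjoint :: "'a::banach set \<Rightarrow> ('a \<Rightarrow> 'a) \<Rightarrow> ('a \<Rightarrow>\<^sub>L real) \<Rightarrow> ('a \<Rightarrow>\<^sub>L real)" where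
  "banach_adjoint D A f = (THE g :: 'a \<Rightarrow>\<^sub>L real. \<forall>x\<in>D. f (A x) = g x)"

lift_definition dual_blinfun ::
  "('a::real_normed_vector \<Rightarrow>\<^sub>L 'b::real_normed_vector) \<Rightarrow> ('b \<Rightarrow>\<^sub>L real) \<Rightarrow>\<^sub>L ('a \<Rightarrow>\<^sub>L real)"
  is "\<lambda>S f. f o\<^sub>L S"
  by (rule bounded_bilinear.bounded_linear_left[OF bounded_bilinear_blinfun_compose])

lemma dual_blinfun_apply [simp]: "dual_blinfun S f = f o\<^sub>L S"
  by (simp add: dual_blinfun.rep_eq)

text \<open>The Hilbert space \<open>'v\<close> is identified with its dual through \<open>v \<mapsto> \<langle>v, \<cdot>\<rangle>\<close>.\<close>

definition hilbert_adjoint ::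
  "('a::real_normed_vector \<Rightarrow>\<^sub>L 'v::real_inner) \<Rightarrow> 'v \<Rightarrow>\<^sub>L ('a \<Rightarrow>\<^sub>L real)" where
  "hilbert_adjoint C = dual_blinfun C o\<^sub>L Blinfun blinfun_inner_right"

lemma hilbert_adjoint_apply: "hilbert_adjoint C v x = v \<bullet> C x"
  by (simp add: hilbert_adjoint_def bounded_linear_Blinfun_apply
      bounded_linear_blinfun_inner_right)

section \<open>Symmetric and positive definite operators\<close>

definition symmetric_ops :: "('a::real_normed_vector \<Rightarrow>\<^sub>L 'a \<Rightarrow>\<^sub>L real) set" where
  "symmetric_ops = {P :: 'a \<Rightarrow>\<^sub>L 'a \<Rightarrow>\<^sub>L real. \<forall>x y. P x y = P y x}"

definition positive_ops :: "('a::real_normed_vector \<Rightarrow>\<^sub>L 'a \<Rightarrow>\<^sub>L real) set" where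
  "positive_ops = {P \<in> symmetric_ops. \<forall>x. P x x \<ge> 0}"

definition nonneg_map ::
  "(('a::real_normed_vector \<Rightarrow>\<^sub>L 'a \<Rightarrow>\<^sub>L real) \<Rightarrow> ('a \<Rightarrow>\<^sub>L 'a \<Rightarrow>\<^sub>L real)) \<Rightarrow> bool" where
  "nonneg_map M \<longleftrightarrow> M ` positive_ops \<subseteq> positive_ops"

section \<open>The projective tensor product\<close>

text \<open>The completed projective tensor product of \<open>X\<close> and \<open>Y\<close> is realised inside the dual of
  \<open>B(X,Y*)\<close>: the tensor of \<open>x\<close> and \<open>y\<close> is the functional \<open>P \<mapsto> \<langle>P x, y\<rangle>\<close>. The lemma
  \<open>sum_tensor_eq_iff\<close> shows that the span of these functionals is the algebraic tensor
  product, and \<open>norm_eq_projective_norm\<close> that the dual norm is the projective norm there.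
  The completion is therefore the closure in the (complete) dual space, and evaluation is
  the duality pairing.\<close>

lift_definition tensor ::
  "'a::real_normed_vector \<Rightarrow> 'b::real_normed_vector \<Rightarrow> ('a \<Rightarrow>\<^sub>L 'b \<Rightarrow>\<^sub>L real) \<Rightarrow>\<^sub>L real"
  is "\<lambda>(x::'a) (y::'b) (P :: 'a \<Rightarrow>\<^sub>L 'b \<Rightarrow>\<^sub>L real). P x y"
  by (intro bounded_linear_intros)

lemma tensor_apply [simp]: "tensor x y P = P x y"
  by (simp add: tensor.rep_eq)

definition projective_norm ::
  "(('a::real_normed_vector \<Rightarrow>\<^sub>L 'b::real_normed_vector \<Rightarrow>\<^sub>L real) \<Rightarrow>\<^sub>L real) \<Rightarrow> real" where
  "projective_norm u =
     Inf {(\<Sum>i<n. norm (x i) * norm (y i)) | (n::nat) x y. u = (\<Sum>i<n. tensor (x i) (y i))}"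

subsection \<open>Hahn-Banach\<close>

lemma hahn_banach_seminorm:
  fixes p :: "'a::real_vector \<Rightarrow> real"
  assumes W: "subspace W" and u0: "u0 \<in> W"
    and tri: "\<And>x y. x \<in> W \<Longrightarrow> y \<in> W \<Longrightarrow> p (x + y) \<le> p x + p y"
    and hom: "\<And>c x. x \<in> W \<Longrightarrow> p (c *\<^sub>R x) = \<bar>c\<bar> * p x"
  obtains f where "\<And>x y. x \<in> W \<Longrightarrow> y \<in> W \<Longrightarrow> f (x + y) = f x + f y"
    and "\<And>c x. x \<in> W \<Longrightarrow> f (c *\<^sub>R x) = c * f x"
    and "\<And>x. x \<in> W \<Longrightarrow> \<bar>f x\<bar> \<le> p x"
    and "f u0 = p u0"
proof -
  have p0: "p 0 = 0"
    using hom[OF subspace_0[OF W], of 0] by simp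
  have pneg: "p (- x) = p x" if "x \<in> W" for x
    using hom[OF that, of "-1"] by simp
  have pnn: "0 \<le> p x" if "x \<in> W" for x
    using tri[OF that subspace_neg[OF W that]] pneg[OF that] p0 by simp
  define \<A> where "\<A> = {G :: ('a \<times> real) set.
    subspace G \<and> (u0, p u0) \<in> G \<and> (\<forall>(x, r)\<in>G. x \<in> W \<and> r \<le> p x)}"
  define G0 where "G0 = range (\<lambda>c. (c *\<^sub>R u0, c * p u0))"
  have "G0 \<in> \<A>"
  proof -
    have "subspace G0"
      unfolding G0_def subspace_def
      by (auto simp: image_iff zero_prod_def simp flip: scaleR_add_left distrib_right)
    moreover have "(u0, p u0) \<in> G0"
      unfolding G0_def by (rule range_eqI[of _ _ 1]) simp
    moreover have "x \<in> W \<and> r \<le> p x" if "(x, r) \<in> G0" for x r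
    proof -
      from that obtain c where c: "x = c *\<^sub>R u0" "r = c * p u0"
        unfolding G0_def by auto
      show ?thesis
        unfolding c hom[OF u0] using pnn[OF u0] subspace_scale[OF W u0]
        by (auto intro: mult_right_mono)
    qed
    ultimately show ?thesis unfolding \<A>_def by auto
  qed
  have "\<exists>G\<in>\<A>. \<forall>X\<in>\<A>. G \<subseteq> X \<longrightarrow> X = G"
  proof (rule subset_Zorn_nonempty)
    show "\<A> \<noteq> {}" using \<open>G0 \<in> \<A>\<close> by blast
    fix \<C> assume ne: "\<C> \<noteq> {}" and ch: "subset.chain \<A> \<C>"
    then have sub: "\<C> \<subseteq> \<A>" and tot: "\<And>X Y. X \<in> \<C> \<Longrightarrow> Y \<in> \<C> \<Longrightarrow> X \<subseteq> Y \<or> Y \<subseteq> X"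
      by (auto simp: subset_chain_def)
    have sp: "subspace X" if "X \<in> \<C>" for X
      using that sub by (auto simp: \<A>_def)
    have "subspace (\<Union>\<C>)"
      unfolding subspace_def
    proof (intro conjI ballI allI)
      show "0 \<in> \<Union>\<C>"
        using ne sp subspace_0 by blast
      fix a b assume "a \<in> \<Union>\<C>" "b \<in> \<Union>\<C>"
      then obtain X Y where "X \<in> \<C>" "Y \<in> \<C>" "a \<in> X" "b \<in> Y" by blast
      with tot obtain Z where "Z \<in> \<C>" "a \<in> Z" "b \<in> Z" by blast
      then show "a + b \<in> \<Union>\<C>"
        using sp subspace_add by blast
    next
      fix c :: real and a assume "a \<in> \<Union>\<C>"
      then show "c *\<^sub>R a \<in> \<Union>\<C>"
        using sp subspace_scale by blast
    qed
    then show "\<Union>\<C> \<in> \<A>"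
      using ne sub unfolding \<A>_def by blast
  qed
  then obtain G where G: "G \<in> \<A>" and max: "\<And>X. X \<in> \<A> \<Longrightarrow> G \<subseteq> X \<Longrightarrow> X = G"
    by blast
  have sG: "subspace G" and uG: "(u0, p u0) \<in> G"
    and bG: "\<And>x r. (x, r) \<in> G \<Longrightarrow> x \<in> W \<and> r \<le> p x"
    using G unfolding \<A>_def by auto
  have addG: "(x + y, r + s) \<in> G" if "(x, r) \<in> G" "(y, s) \<in> G" for x y r s
    using subspace_add[OF sG that] by simp
  have scG: "(c *\<^sub>R x, c * r) \<in> G" if "(x, r) \<in> G" for c x r
    using subspace_scale[OF sG that, of c] by simp
  have uniq: "r = s" if "(x, r) \<in> G" "(x, s) \<in> G" for x r s
  proof -
    have "(x + (-1) *\<^sub>R x, r + (-1) * s) \<in> G"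
      by (rule addG[OF that(1) scG[OF that(2)]])
    moreover have "(x + (-1) *\<^sub>R x, s + (-1) * r) \<in> G"
      by (rule addG[OF that(2) scG[OF that(1)]])
    ultimately show ?thesis using p0 by (auto dest!: bG)
  qed
  have total: "\<exists>r. (z, r) \<in> G" if z: "z \<in> W" for z
  proof (rule ccontr)
    assume nz: "\<nexists>r. (z, r) \<in> G"
    define S where "S = {r - p (x - z) | x r. (x, r) \<in> G}"
    define c where "c = Sup S"
    have 00: "(0, 0) \<in> G" using subspace_0[OF sG] by (simp add: zero_prod_def)
    have ub: "s \<le> p (y + z) - r'" if "s \<in> S" "(y, r') \<in> G" for s y r'
    proof -
      from that obtain x r where s: "s = r - p (x - z)" and x: "(x, r) \<in> G"
        unfolding S_def by auto
      have xW: "x \<in> W" and yW: "y \<in> W" using bG x that by auto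
      have "r + r' \<le> p (x + y)" using bG addG x that by blast
      also have "x + y = (x - z) + (y + z)" by simp
      also have "p \<dots> \<le> p (x - z) + p (y + z)"
        using tri subspace_diff[OF W xW z] subspace_add[OF W yW z] by blast
      finally show ?thesis unfolding s by simp
    qed
    have "S \<noteq> {}" using 00 unfolding S_def by blast
    then have cle: "c \<le> p (y + z) - r'" if "(y, r') \<in> G" for y r'
      unfolding c_def using ub that by (intro cSup_least) auto
    have lec: "r - p (x - z) \<le> c" if "(x, r) \<in> G" for x r
      unfolding c_def using ub[OF _ 00] that
      by (intro cSup_upper) (auto simp: S_def bdd_above_def)
    define G' where "G' = {(x + s *\<^sub>R z, r + s * c) | x r s. (x, r) \<in> G}"
    have "subspace G'"
      unfolding subspace_def
    proof (intro conjI ballI allI)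
      show "0 \<in> G'"
        unfolding G'_def using 00 by (force simp: zero_prod_def)
    next
      fix a b assume "a \<in> G'" "b \<in> G'"
      then obtain x r s y r' s' where
        "a = (x + s *\<^sub>R z, r + s * c)" "b = (y + s' *\<^sub>R z, r' + s' * c)"
        "(x, r) \<in> G" "(y, r') \<in> G"
        unfolding G'_def by auto
      then have "a + b = ((x + y) + (s + s') *\<^sub>R z, (r + r') + (s + s') * c)"
        "(x + y, r + r') \<in> G"
        using addG by (simp_all add: scaleR_add_left distrib_right)
      then show "a + b \<in> G'" unfolding G'_def by blast
    next
      fix k :: real and a assume "a \<in> G'"
      then obtain x r s where "a = (x + s *\<^sub>R z, r + s * c)" "(x, r) \<in> G"
        unfolding G'_def by auto
      then have "k *\<^sub>R a = (k *\<^sub>R x + (k * s) *\<^sub>R z, k * r + (k * s) * c)"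
        "(k *\<^sub>R x, k * r) \<in> G"
        using scG by (simp_all add: scaleR_add_right distrib_left)
      then show "k *\<^sub>R a \<in> G'" unfolding G'_def by blast
    qed
    moreover have GG': "G \<subseteq> G'"
    proof
      fix a assume "a \<in> G"
      then show "a \<in> G'"
        unfolding G'_def mem_Collect_eq
        by (intro exI[of _ "fst a"] exI[of _ "snd a"] exI[of _ 0]) simp
    qed
    moreover have "x \<in> W \<and> r \<le> p x" if "(x, r) \<in> G'" for x r
    proof -
      from that obtain y q s where e: "x = y + s *\<^sub>R z" "r = q + s * c" and y: "(y, q) \<in> G"
        unfolding G'_def by auto
      have yW: "y \<in> W" using bG y by blast
      have xW: "x \<in> W" unfolding e using subspace_add[OF W yW subspace_scale[OF W z]] .
      have "r \<le> p x"
      proof (cases s "0::real" rule: linorder_cases)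
        case equal
        then show ?thesis using bG y e by simp
      next
        case greater
        have *: "((1/s) *\<^sub>R y, (1/s) * q) \<in> G" using scG y by blast
        have "s * c \<le> s * (p ((1/s) *\<^sub>R y + z) - (1/s) * q)"
          using cle[OF *] greater by simp
        also have "\<dots> = p (s *\<^sub>R ((1/s) *\<^sub>R y + z)) - q"
          using greater hom[of "(1/s) *\<^sub>R y + z" s] yW z W
          by (simp add: algebra_simps subspace_add subspace_scale)
        also have "s *\<^sub>R ((1/s) *\<^sub>R y + z) = x"
          using greater e by (simp add: algebra_simps)
        finally show ?thesis using e by simp
      next
        case less
        define t where "t = - s"
        have t: "t > 0" "s = - t" using less t_def by auto
        have *: "((1/t) *\<^sub>R y, (1/t) * q) \<in> G" using scG y by blast
        have "t * ((1/t) * q - p ((1/t) *\<^sub>R y - z)) \<le> t * c"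
          using lec[OF *] t by simp
        moreover have "t * ((1/t) * q - p ((1/t) *\<^sub>R y - z)) = q - p (t *\<^sub>R ((1/t) *\<^sub>R y - z))"
          using t hom[of "(1/t) *\<^sub>R y - z" t] yW z W
          by (simp add: algebra_simps subspace_diff subspace_scale)
        moreover have "t *\<^sub>R ((1/t) *\<^sub>R y - z) = x"
          using t e by (simp add: algebra_simps)
        ultimately have "q - p x \<le> t * c" by simp
        then show ?thesis using e t by simp
      qed
      with xW show ?thesis by blast
    qed
    ultimately have "G' \<in> \<A>" using uG unfolding \<A>_def by auto
    then have "G' = G" using max GG' by blast
    moreover have "(0 + 1 *\<^sub>R z, 0 + 1 * c) \<in> G'" unfolding G'_def using 00 by blast
    ultimately show False using nz by simp
  qed
  define f where "f x = (THE r. (x, r) \<in> G)" for x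
  have fG: "f x = r" if "(x, r) \<in> G" for x r
    unfolding f_def using that uniq by blast
  have Gf: "(x, f x) \<in> G" if "x \<in> W" for x
    using total[OF that] fG by blast
  show thesis
  proof
    show "f (x + y) = f x + f y" if "x \<in> W" "y \<in> W" for x y
      using fG[OF addG[OF Gf Gf]] that by blast
    show "f (c *\<^sub>R x) = c * f x" if "x \<in> W" for c x
      using fG[OF scG[OF Gf]] that by blast
    show "\<bar>f x\<bar> \<le> p x" if "x \<in> W" for x
      using bG[OF Gf[OF that]] bG[OF scG[OF Gf[OF that], of "-1"]] pneg[OF that] by auto
    show "f u0 = p u0" using fG uG by blast
  qed
qed

lemma bounded_functional_nonzero:
  fixes w :: "'a::real_normed_vector"
  assumes "w \<noteq> 0"
  obtains f :: "'a \<Rightarrow>\<^sub>L real" where "f w = 1"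
proof -
  obtain f :: "'a \<Rightarrow> real" where f: "\<And>x y. f (x + y) = f x + f y" "\<And>c x. f (c *\<^sub>R x) = c * f x"
    "\<And>x. \<bar>f x\<bar> \<le> norm x" "f w = norm w"
    by (rule hahn_banach_seminorm[OF subspace_UNIV UNIV_I, of norm w])
       (auto simp: norm_triangle_ineq)
  have bl: "bounded_linear (\<lambda>x. f x / norm w)"
    by (rule bounded_linear_intro[where K = "1 / norm w"])
       (auto simp: f add_divide_distrib intro: divide_right_mono)
  show thesis
  proof
    show "Blinfun (\<lambda>x. f x / norm w) w = 1"
      using assms by (simp add: bounded_linear_Blinfun_apply[OF bl] f)
  qed
qed

subsection \<open>Identification with the textbook tensor product\<close>

lemma sum_tensor_eq_iff:
  fixes x :: "'i \<Rightarrow> 'a::real_normed_vector" and y :: "'i \<Rightarrow> 'b::real_normed_vector"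
  assumes "finite I"
  shows "(\<Sum>i\<in>I. tensor (x i) (y i)) = 0 \<longleftrightarrow>
    (\<forall>B :: 'a \<Rightarrow> 'b \<Rightarrow> real. bilinear B \<longrightarrow> (\<Sum>i\<in>I. B (x i) (y i)) = 0)"
proof
  assume R: "\<forall>B :: 'a \<Rightarrow> 'b \<Rightarrow> real. bilinear B \<longrightarrow> (\<Sum>i\<in>I. B (x i) (y i)) = 0"
  show "(\<Sum>i\<in>I. tensor (x i) (y i)) = 0"
  proof (rule blinfun_eqI)
    fix P :: "'a \<Rightarrow>\<^sub>L 'b \<Rightarrow>\<^sub>L real"
    have "bilinear (\<lambda>x y. P x y)"
      by (auto simp: bilinear_def blinfun.bilinear_simps intro!: linearI)
    then have "(\<Sum>i\<in>I. P (x i) (y i)) = 0"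
      using R[rule_format, of "\<lambda>x y. P x y"] by blast
    then show "(\<Sum>i\<in>I. tensor (x i) (y i)) P = blinfun_apply 0 P"
      by (simp add: blinfun.sum_left)
  qed
next
  assume L: "(\<Sum>i\<in>I. tensor (x i) (y i)) = 0"
  have fg: "(\<Sum>i\<in>I. f (x i) * g (y i)) = 0" for f :: "'a \<Rightarrow>\<^sub>L real" and g :: "'b \<Rightarrow>\<^sub>L real"
  proof -
    define P :: "'a \<Rightarrow>\<^sub>L 'b \<Rightarrow>\<^sub>L real" where "P = blinfun_scaleR_left g o\<^sub>L f"
    have "(\<Sum>i\<in>I. tensor (x i) (y i)) P = (\<Sum>i\<in>I. f (x i) * g (y i))"
      by (simp add: blinfun.sum_left P_def blinfun.scaleR_left)
    then show ?thesis using L by simp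
  qed
  have "bilinear B \<longrightarrow> (\<Sum>i\<in>I. B (x i) (y i)) = 0" for B :: "'a \<Rightarrow> 'b \<Rightarrow> real"
    using assms fg
  proof (induction I arbitrary: x rule: finite_induct)
    case empty
    then show ?case by simp
  next
    case (insert k J)
    show ?case
    proof
      assume B: "bilinear B"
      note Bs = bilinear_ladd[OF B] bilinear_radd[OF B] bilinear_lmul[OF B] bilinear_rmul[OF B]
        bilinear_lsub[OF B] bilinear_rsub[OF B] bilinear_lzero[OF B] bilinear_rzero[OF B]
      show "(\<Sum>i\<in>insert k J. B (x i) (y i)) = 0"
      proof (cases "x k = 0")
        case True
        have "(\<Sum>i\<in>J. f (x i) * g (y i)) = 0" for f :: "'a \<Rightarrow>\<^sub>L real" and g :: "'b \<Rightarrow>\<^sub>L real"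
          using insert.prems[of f g] insert.hyps True by simp
        then show ?thesis
          using insert.IH[of x] B insert.hyps True by (simp add: Bs)
      next
        case False
        then obtain h :: "'a \<Rightarrow>\<^sub>L real" where h: "h (x k) = 1"
          using bounded_functional_nonzero by blast
        define w where "w = y k + (\<Sum>i\<in>J. h (x i) *\<^sub>R y i)"
        have "w = 0"
        proof (rule ccontr)
          assume "w \<noteq> 0"
          then obtain g :: "'b \<Rightarrow>\<^sub>L real" where "g w = 1"
            using bounded_functional_nonzero by blast
          moreover have "g w = 0"
            using insert.prems[of h g] insert.hyps h
            by (simp add: w_def blinfun.bilinear_simps blinfun.sum_right)
          ultimately show False by simp
        qed
        then have yk: "y k = - (\<Sum>i\<in>J. h (x i) *\<^sub>R y i)"
          unfolding w_def by (simp add: add_eq_0_iff2)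
        have split: "(\<Sum>i\<in>J. B (x i - h (x i) *\<^sub>R x k) (y i)) = (\<Sum>i\<in>insert k J. B (x i) (y i))"
          if "bilinear B" for B :: "'a \<Rightarrow> 'b \<Rightarrow> real"
        proof -
          have l: "linear (B (x k))" using that by (simp add: bilinear_def)
          show ?thesis
            using insert.hyps
            by (simp add: yk bilinear_lsub[OF that] bilinear_lmul[OF that] linear_neg[OF l]
                linear_sum[OF l] linear_scale[OF l] sum_subtractf)
        qed
        have "(\<Sum>i\<in>J. f (x i - h (x i) *\<^sub>R x k) * g (y i)) = 0"
          for f :: "'a \<Rightarrow>\<^sub>L real" and g :: "'b \<Rightarrow>\<^sub>L real"
        proof -
          have "bilinear (\<lambda>x y. f x * g y)"
            by (auto simp: bilinear_def blinfun.bilinear_simps algebra_simps intro!: linearI)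
          from split[OF this] show ?thesis using insert.prems[of f g] by simp
        qed
        then show ?thesis
          using insert.IH[of "\<lambda>i. x i - h (x i) *\<^sub>R x k"] B split[OF B] by simp
      qed
    qed
  qed
  then show "\<forall>B :: 'a \<Rightarrow> 'b \<Rightarrow> real. bilinear B \<longrightarrow> (\<Sum>i\<in>I. B (x i) (y i)) = 0"
    by blast
qed

lemma tensor_add_left: "tensor (x + x') y = tensor x y + tensor x' y"
  and tensor_add_right: "tensor x (y + y') = tensor x y + tensor x y'"
  and tensor_scaleR_left: "tensor (c *\<^sub>R x) y = c *\<^sub>R tensor x y"
  and tensor_scaleR_right: "tensor x (c *\<^sub>R y) = c *\<^sub>R tensor x y"
  by (auto intro!: blinfun_eqI simp: blinfun.bilinear_simps)

lemma norm_tensor_le: "norm (tensor x y) \<le> norm x * norm y"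
proof (rule norm_blinfun_bound)
  fix P :: "'a \<Rightarrow>\<^sub>L 'b \<Rightarrow>\<^sub>L real"
  have "norm (P x y) \<le> norm (P x) * norm y" by (rule norm_blinfun)
  also have "\<dots> \<le> (norm P * norm x) * norm y"
    by (intro mult_right_mono norm_blinfun) auto
  finally show "norm (tensor x y P) \<le> norm x * norm y * norm P"
    by (simp add: mult_ac)
qed simp

text \<open>Elementary tensors absorb scalars, so the span consists of finite sums of tensors.\<close>

lemma span_tensor_iff:
  "u \<in> span {tensor x y | x y. True} \<longleftrightarrow> (\<exists>(n::nat) x y. u = (\<Sum>i<n. tensor (x i) (y i)))"
  (is "u \<in> span ?T \<longleftrightarrow> ?R u")
proof
  show "?R u" if "u \<in> span ?T"
    using that
  proof (induction rule: span_induct_alt)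
    case base
    show ?case by (rule exI[of _ 0]) simp
  next
    case (step c a v)
    then obtain x y n x' y' where "a = tensor x y" "v = (\<Sum>i<(n::nat). tensor (x' i) (y' i))"
      by blast
    then have "c *\<^sub>R a + v =
      (\<Sum>i<Suc n. tensor ((x'(n := c *\<^sub>R x)) i) ((y'(n := y)) i))"
      by (simp add: tensor_scaleR_left)
    then show ?case by blast
  qed
  show "u \<in> span ?T" if "?R u"
  proof -
    from that obtain n x y where u: "u = (\<Sum>i<(n::nat). tensor (x i) (y i))" by blast
    show ?thesis unfolding u by (intro span_sum span_base) blast
  qed
qed

lemma norm_eq_projective_norm:
  fixes u :: "('a::real_normed_vector \<Rightarrow>\<^sub>L 'b::real_normed_vector \<Rightarrow>\<^sub>L real) \<Rightarrow>\<^sub>L real"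
  assumes u: "u \<in> span {tensor x y | x y. True}"
  shows "norm u = projective_norm u"
proof -
  let ?W = "span {tensor x y | (x::'a) (y::'b). True}"
  define N where "N u = {(\<Sum>i<n. norm (x i) * norm (y i)) | (n::nat) (x::nat \<Rightarrow> 'a) (y::nat \<Rightarrow> 'b).
    u = (\<Sum>i<n. tensor (x i) (y i))}" for u
  have pN: "projective_norm u = Inf (N u)" for u :: "('a \<Rightarrow>\<^sub>L 'b \<Rightarrow>\<^sub>L real) \<Rightarrow>\<^sub>L real"
    unfolding projective_norm_def N_def ..
  have Nne: "N u \<noteq> {}" if "u \<in> ?W" for u
    using that unfolding span_tensor_iff N_def by blast
  have lower: "norm u \<le> r" if "r \<in> N u" for u r
  proof -
    from that obtain n x y where r: "r = (\<Sum>i<n. norm (x i) * norm (y i))"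
      and u: "u = (\<Sum>i<(n::nat). tensor (x i) (y i))" unfolding N_def by blast
    show ?thesis unfolding u r by (intro order.trans[OF norm_sum] sum_mono norm_tensor_le)
  qed
  have bdd: "bdd_below (N u)" for u
    using lower unfolding bdd_below_def by blast
  have le: "norm u \<le> projective_norm u" if "u \<in> ?W" for u
    unfolding pN using Nne[OF that] lower by (intro cInf_greatest)
  have addN: "r + s \<in> N (u + v)" if "r \<in> N u" "s \<in> N v" for r s u v
  proof -
    from that obtain n x y m x' y' where
      r: "r = (\<Sum>i<n. norm (x i) * norm (y i))" and u: "u = (\<Sum>i<(n::nat). tensor (x i) (y i))" and
      s: "s = (\<Sum>i<m. norm (x' i) * norm (y' i))" and v: "v = (\<Sum>i<(m::nat). tensor (x' i) (y' i))"
      unfolding N_def by blast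
    define X where "X i = (if i < n then x i else x' (i - n))" for i
    define Y where "Y i = (if i < n then y i else y' (i - n))" for i
    have sp: "(\<Sum>i<n+m. h (X i) (Y i)) = (\<Sum>i<n. h (x i) (y i)) + (\<Sum>i<m. h (x' i) (y' i))"
      for h :: "'a \<Rightarrow> 'b \<Rightarrow> 'c::comm_monoid_add"
    proof -
      have "(\<Sum>i<n+m. h (X i) (Y i)) = (\<Sum>i<n. h (X i) (Y i)) + (\<Sum>i<m. h (X (n+i)) (Y (n+i)))"
        by (induction m) (auto simp: add.assoc)
      also have "(\<Sum>i<n. h (X i) (Y i)) = (\<Sum>i<n. h (x i) (y i))"
        by (intro sum.cong) (auto simp: X_def Y_def)
      finally show ?thesis by (simp add: X_def Y_def)
    qed
    show ?thesis
      unfolding N_def r s u v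
      using sp[of "\<lambda>a b. norm a * norm b", symmetric] sp[of tensor, symmetric] by blast
  qed
  have scN: "\<bar>c\<bar> * r \<in> N (c *\<^sub>R u)" if "r \<in> N u" for r c u
  proof -
    from that obtain n x y where r: "r = (\<Sum>i<n. norm (x i) * norm (y i))"
      and u: "u = (\<Sum>i<(n::nat). tensor (x i) (y i))" unfolding N_def by blast
    have "\<bar>c\<bar> * r = (\<Sum>i<n. norm (c *\<^sub>R x i) * norm (y i))"
      "c *\<^sub>R u = (\<Sum>i<n. tensor (c *\<^sub>R x i) (y i))"
      by (simp_all add: r u sum_distrib_left mult.assoc scaleR_sum_right tensor_scaleR_left)
    then show ?thesis
      unfolding N_def mem_Collect_eq by (intro exI[of _ n] exI[of _ "\<lambda>i. c *\<^sub>R x i"] exI[of _ y]) simp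
  qed
  have tri: "projective_norm (u + v) \<le> projective_norm u + projective_norm v"
    if "u \<in> ?W" "v \<in> ?W" for u v
  proof -
    have "projective_norm (u + v) - s \<le> projective_norm u" if "s \<in> N v" for s
      unfolding pN[of u]
    proof (rule cInf_greatest[OF Nne[OF \<open>u \<in> ?W\<close>]])
      fix r assume "r \<in> N u"
      then show "projective_norm (u + v) - s \<le> r"
        unfolding pN using cInf_lower[OF addN[OF _ that] bdd] by (simp add: algebra_simps)
    qed
    then have "projective_norm (u + v) - projective_norm u \<le> s" if "s \<in> N v" for s
      using that by (simp add: algebra_simps)
    then have "projective_norm (u + v) - projective_norm u \<le> projective_norm v"
      unfolding pN[of v] by (intro cInf_greatest[OF Nne[OF that(2)]])
    then show ?thesis by simp
  qed
  have hle: "projective_norm (c *\<^sub>R u) \<le> \<bar>c\<bar> * projective_norm u" if "u \<in> ?W" for c u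
  proof (cases "c = 0")
    case True
    have "0 \<in> N 0" unfolding N_def mem_Collect_eq by (rule exI[of _ 0]) simp
    then have "projective_norm (0 :: ('a \<Rightarrow>\<^sub>L 'b \<Rightarrow>\<^sub>L real) \<Rightarrow>\<^sub>L real) \<le> 0"
      unfolding pN by (rule cInf_lower[OF _ bdd])
    then show ?thesis using True by simp
  next
    case False
    have "projective_norm (c *\<^sub>R u) / \<bar>c\<bar> \<le> projective_norm u"
      unfolding pN[of u]
    proof (rule cInf_greatest[OF Nne[OF that]])
      fix r assume "r \<in> N u"
      then have "projective_norm (c *\<^sub>R u) \<le> \<bar>c\<bar> * r"
        unfolding pN by (intro cInf_lower[OF scN bdd])
      then show "projective_norm (c *\<^sub>R u) / \<bar>c\<bar> \<le> r"
        using False by (simp add: field_simps)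
    qed
    then show ?thesis using False by (simp add: field_simps)
  qed
  have hom: "projective_norm (c *\<^sub>R u) = \<bar>c\<bar> * projective_norm u" if "u \<in> ?W" for c u
  proof (cases "c = 0")
    case True
    then show ?thesis
      using hle[OF that, of c] le[OF span_zero] by simp
  next
    case False
    have "projective_norm ((1/c) *\<^sub>R c *\<^sub>R u) \<le> \<bar>1/c\<bar> * projective_norm (c *\<^sub>R u)"
      using that by (intro hle span_scale)
    then have "\<bar>c\<bar> * projective_norm u \<le> projective_norm (c *\<^sub>R u)"
      using False by (simp add: field_simps)
    then show ?thesis using hle[OF that, of c] by simp
  qed
  obtain f where fadd: "\<And>v w. v \<in> ?W \<Longrightarrow> w \<in> ?W \<Longrightarrow> f (v + w) = f v + f w"
    and fsc: "\<And>c v. v \<in> ?W \<Longrightarrow> f (c *\<^sub>R v) = c * f v"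
    and fle: "\<And>v. v \<in> ?W \<Longrightarrow> \<bar>f v\<bar> \<le> projective_norm v"
    and fu: "f u = projective_norm u"
    using hahn_banach_seminorm[OF subspace_span u tri hom] by blast
  have tW: "tensor x y \<in> ?W" for x y
    by (intro span_base) blast
  have ft: "\<bar>f (tensor x y)\<bar> \<le> norm x * norm y" for x y
  proof -
    have "norm x * norm y \<in> N (tensor x y)"
      unfolding N_def mem_Collect_eq
      by (rule exI[of _ 1], rule exI[of _ "\<lambda>_. x"], rule exI[of _ "\<lambda>_. y"]) simp
    then have "projective_norm (tensor x y) \<le> norm x * norm y"
      unfolding pN by (rule cInf_lower[OF _ bdd])
    then show ?thesis using fle[OF tW, of x y] by simp
  qed
  have bb: "bounded_bilinear (\<lambda>x y. f (tensor x y))"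
  proof (unfold_locales, goal_cases)
    case 5
    show ?case using ft by (intro exI[of _ 1]) simp
  qed (simp_all add: tensor_add_left tensor_add_right tensor_scaleR_left tensor_scaleR_right
        fadd[OF tW tW] fsc[OF tW])
  interpret bb: bounded_bilinear "\<lambda>x y. f (tensor x y)" by (fact bb)
  define P where "P = Blinfun (\<lambda>x. bb.prod_right x)"
  have P: "P x y = f (tensor x y)" for x y
    unfolding P_def by (simp add: bounded_linear_Blinfun_apply[OF bb.bounded_linear_prod_right])
  have "norm P \<le> 1"
  proof (rule norm_blinfun_bound)
    fix x show "norm (P x) \<le> 1 * norm x"
      by (rule norm_blinfun_bound) (use ft in \<open>auto simp: P\<close>)
  qed simp
  have f0: "f 0 = 0" using fsc[OF span_zero, of 0] by simp
  obtain n x y where un: "u = (\<Sum>i<(n::nat). tensor (x i) (y i))"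
    using u unfolding span_tensor_iff by blast
  have "f (\<Sum>i<k. tensor (x i) (y i)) = (\<Sum>i<k. f (tensor (x i) (y i)))" for k
    by (induction k) (simp_all add: f0 fadd[OF span_sum[OF tW] tW])
  then have "u P = f u" by (simp add: un blinfun.sum_left P)
  then have "projective_norm u \<le> norm (u P)" using fu by simp
  also have "\<dots> \<le> norm u * norm P" by (rule norm_blinfun)
  also have "\<dots> \<le> norm u" using \<open>norm P \<le> 1\<close> by (simp add: mult_left_le)
  finally show ?thesis using le[OF u] by simp
qed

section \<open>The weak* topology and the Lyapunov generator\<close>

definition symmetric_tensors ::
  "(('a::real_normed_vector \<Rightarrow>\<^sub>L 'a \<Rightarrow>\<^sub>L real) \<Rightarrow>\<^sub>L real) set" where
  "symmetric_tensors = closure (span {tensor x y + tensor y x | x y. True})"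

definition weak_star_topology :: "('a::real_normed_vector \<Rightarrow>\<^sub>L 'a \<Rightarrow>\<^sub>L real) topology" where
  "weak_star_topology =
     pullback_topology symmetric_ops (\<lambda>P. \<lambda>u\<in>symmetric_tensors. blinfun_apply u P)
       (product_topology (\<lambda>_. euclideanreal) symmetric_tensors)"

lemma topspace_weak_star_topology: "topspace weak_star_topology = symmetric_ops"
  by (auto simp: weak_star_topology_def topspace_pullback_topology)

lemma limitin_weak_star_iff:
  fixes Q :: "'a::real_normed_vector \<Rightarrow>\<^sub>L 'a \<Rightarrow>\<^sub>L real"
  shows "limitin weak_star_topology P Q F \<longleftrightarrow>
     Q \<in> symmetric_ops \<and> (\<forall>\<^sub>F t in F. P t \<in> symmetric_ops) \<and>
     (\<forall>u\<in>symmetric_tensors. ((\<lambda>t. blinfun_apply u (P t)) \<longlongrightarrow> u Q) F)"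
proof -
  define h where "h = (\<lambda>(P :: 'a \<Rightarrow>\<^sub>L 'a \<Rightarrow>\<^sub>L real). \<lambda>u\<in>symmetric_tensors. blinfun_apply u P)"
  let ?X = "product_topology (\<lambda>_. euclideanreal) symmetric_tensors"
  have W: "weak_star_topology = pullback_topology symmetric_ops h ?X"
    by (simp add: weak_star_topology_def h_def)
  have h: "limitin ?X (\<lambda>t. h (P t)) (h Q) F \<longleftrightarrow>
    (\<forall>u\<in>symmetric_tensors. ((\<lambda>t. blinfun_apply u (P t)) \<longlongrightarrow> u Q) F)"
    by (simp add: limitin_componentwise h_def)
  show ?thesis
  proof
    assume L: "limitin weak_star_topology P Q F"
    have "Q \<in> symmetric_ops"
      using limitin_topspace[OF L] by (simp add: topspace_weak_star_topology)
    moreover have "\<forall>\<^sub>F t in F. P t \<in> symmetric_ops"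
      using L openin_topspace[of "weak_star_topology :: ('a \<Rightarrow>\<^sub>L 'a \<Rightarrow>\<^sub>L real) topology"]
      by (simp add: limitin_def topspace_weak_star_topology)
    moreover have "continuous_map weak_star_topology ?X (id \<circ> h)"
      unfolding W by (intro continuous_map_pullback) simp
    then have "limitin ?X (\<lambda>t. h (P t)) (h Q) F"
      using continuous_map_limit[OF _ L] by (simp add: o_def)
    ultimately show "Q \<in> symmetric_ops \<and> (\<forall>\<^sub>F t in F. P t \<in> symmetric_ops) \<and>
     (\<forall>u\<in>symmetric_tensors. ((\<lambda>t. blinfun_apply u (P t)) \<longlongrightarrow> u Q) F)"
      using h by blast
  next
    assume R: "Q \<in> symmetric_ops \<and> (\<forall>\<^sub>F t in F. P t \<in> symmetric_ops) \<and>
     (\<forall>u\<in>symmetric_tensors. ((\<lambda>t. blinfun_apply u (P t)) \<longlongrightarrow> u Q) F)"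
    show "limitin weak_star_topology P Q F"
      unfolding limitin_def topspace_weak_star_topology
    proof (intro conjI allI impI)
      show "Q \<in> symmetric_ops" using R by blast
      fix U :: "('a \<Rightarrow>\<^sub>L 'a \<Rightarrow>\<^sub>L real) set"
      assume "openin weak_star_topology U \<and> Q \<in> U"
      then obtain V where V: "openin ?X V" "U = h -` V \<inter> symmetric_ops" "h Q \<in> V"
        unfolding W openin_pullback_topology by blast
      then have "\<forall>\<^sub>F t in F. h (P t) \<in> V"
        using R h unfolding limitin_def by blast
      then show "\<forall>\<^sub>F t in F. P t \<in> U"
        using R unfolding V(2) by (auto elim: eventually_elim2)
    qed
  qed
qed

definition lyapunov_semigroup ::
  "(real \<Rightarrow> 'a::banach \<Rightarrow>\<^sub>L 'a) \<Rightarrow> real \<Rightarrow> ('a \<Rightarrow>\<^sub>L 'a \<Rightarrow>\<^sub>L real) \<Rightarrow> ('a \<Rightarrow>\<^sub>L 'a \<Rightarrow>\<^sub>L real)" where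
  "lyapunov_semigroup T t P = dual_blinfun (T t) o\<^sub>L P o\<^sub>L T t"

definition lyapunov_limit ::
  "(real \<Rightarrow> 'a::banach \<Rightarrow>\<^sub>L 'a) \<Rightarrow> ('a \<Rightarrow>\<^sub>L 'a \<Rightarrow>\<^sub>L real) \<Rightarrow> ('a \<Rightarrow>\<^sub>L 'a \<Rightarrow>\<^sub>L real) \<Rightarrow> bool" where
  "lyapunov_limit T P Q \<longleftrightarrow>
     limitin weak_star_topology (\<lambda>t. (1 / t) *\<^sub>R (lyapunov_semigroup T t P - P)) Q (at_right 0)"

definition lyapunov_domain ::
  "(real \<Rightarrow> 'a::banach \<Rightarrow>\<^sub>L 'a) \<Rightarrow> ('a \<Rightarrow>\<^sub>L 'a \<Rightarrow>\<^sub>L real) set" where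
  "lyapunov_domain T = {P \<in> symmetric_ops. \<exists>Q. lyapunov_limit T P Q}"

definition lyapunov_generator ::
  "(real \<Rightarrow> 'a::banach \<Rightarrow>\<^sub>L 'a) \<Rightarrow> ('a \<Rightarrow>\<^sub>L 'a \<Rightarrow>\<^sub>L real) \<Rightarrow> ('a \<Rightarrow>\<^sub>L 'a \<Rightarrow>\<^sub>L real)" where
  "lyapunov_generator T P = (THE Q. lyapunov_limit T P Q)"

lemma lyapunov_limit_unique:
  assumes "lyapunov_limit T P Q" "lyapunov_limit T P Q'"
  shows "Q = Q'"
proof -
  have "Q x y = Q' x y" for x y
  proof -
    have u: "tensor x y + tensor y x \<in> symmetric_tensors"
      unfolding symmetric_tensors_def by (intro subsetD[OF closure_subset] span_base) blast
    have "blinfun_apply (tensor x y + tensor y x) Q = blinfun_apply (tensor x y + tensor y x) Q'"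
      using assms u unfolding lyapunov_limit_def limitin_weak_star_iff
      by (intro tendsto_unique[OF trivial_limit_at_right_real]) blast+
    moreover have "Q y x = Q x y" "Q' y x = Q' x y"
      using assms unfolding lyapunov_limit_def limitin_weak_star_iff symmetric_ops_def by auto
    ultimately show ?thesis by (simp add: blinfun.add_left)
  qed
  then show ?thesis by (intro blinfun_eqI) auto
qed

text \<open>An operator \<open>L\<close> with domain \<open>D\<close> has a bounded inverse on the space \<open>S\<close>; the inverse is
  \<open>the_inv_into D L\<close>.\<close>

definition bounded_inverse_on ::
  "'b::real_normed_vector set \<Rightarrow> 'b set \<Rightarrow> ('b \<Rightarrow> 'b) \<Rightarrow> bool" where
  "bounded_inverse_on S D L \<longleftrightarrow>
     bij_betw L D S \<and> (\<exists>K. \<forall>Q\<in>S. norm (the_inv_into D L Q) \<le> K * norm Q)"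

end

(*
  (iii) implies (i): the operator -L_A^{-1}(C*C) is the wanted solution, as one sees by testing the
  weak* limit on tensors of elements of the domain of A.

  (i) implies (ii): the solution makes C T(.) x square integrable, and so, by the variation of
  constants formula T(t) x = S(t) x + int_0^t S(t-s) L C T(s) x ds with the stable semigroup S
  generated by A - L C, is T(.) x itself.  Datko's argument then gives exponential stability.

  (ii) implies (iii): the inverse of L_A is Q |-> - int_0^infinity T*(t) Q T(t) dt.
*)
theory Submission
  imports Defs "HOL-Real_Asymp.Real_Asymp"
begin

text \<open>Two features shape the proof. Orbits are differentiable only for starting points in
  \<open>D\<close>, and the equation in (i) holds only on \<open>D\<close>; so estimates along
  orbits are made on \<open>D\<close>, with constants that see the point only through its norm, and
  density carries them over. Moreover, \<open>T t\<close> depends on \<open>t\<close> continuously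
  only when applied to a vector, not in operator norm; hence the product rule for strongly
  differentiable families, the integral defined form by form, and the passage from single tensors to
  all weak* test functionals by a norm bound. What (i) and (iii) share is the identity
  \<open>P x (A y) + P (A x) y = R x y\<close> for \<open>x\<close>, \<open>y\<close> in
  \<open>D\<close>. It says that along orbits the form of \<open>P\<close> has as derivative the
  form of \<open>R\<close>. For (i), \<open>R\<close> is minus the form of \<open>C\<close>, so
  \<open>P (T s x) (T s x)\<close> is a Lyapunov function whose total decrease pays for the integral
  of \<open>(norm (C (T s x)))\<^sup>2\<close>.\<close>

section \<open>Uniform boundedness, strong limits and derivatives\<close>

text \<open>Baire: the closed sets \<open>E k\<close> cover the space, so one of them contains a
  ball; differences of points of this ball, rescaled, reach every vector.\<close>

lemma uniform_boundedness:
  fixes F :: "'i \<Rightarrow> 'a::banach \<Rightarrow>\<^sub>L 'b::real_normed_vector"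
  assumes "\<And>x. \<exists>K. \<forall>i\<in>I. norm (F i x) \<le> K"
  shows "\<exists>K. \<forall>i\<in>I. norm (F i) \<le> K"
proof -
  define E where "E k = {x. \<forall>i\<in>I. norm (F i x) \<le> real k}" for k :: nat
  have cl: "closed (E k)" for k
    unfolding E_def Collect_ball_eq
    by (intro closed_INT ballI closed_Collect_le continuous_intros)
  have un: "\<Union>(range E) = UNIV"
  proof (intro set_eqI iffI UNIV_I)
    fix x
    obtain K where K: "\<forall>i\<in>I. norm (F i x) \<le> K" using assms by blast
    obtain k where "K \<le> real k" using real_arch_simple by blast
    with K have "x \<in> E k" unfolding E_def by force
    then show "x \<in> \<Union>(range E)" by blast
  qed
  have "\<exists>k. interior (E k) \<noteq> {}"
  proof (rule ccontr)
    assume "\<nexists>k. interior (E k) \<noteq> {}"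
    then have "Met_TC.mtopology interior_of \<Union>(range E) = {}"
      using cl by (intro Met_TC.metric_Baire_category_alt) (auto simp: complete_UNIV mcomplete_iff_complete)
    then show False by (simp add: un)
  qed
  then obtain k x where "x \<in> interior (E k)" by blast
  then obtain r where r: "r > 0" "ball x r \<subseteq> E k"
    by (auto simp: mem_interior)
  have "norm (F i) \<le> 4 * real k / r" if i: "i \<in> I" for i
  proof (rule norm_blinfun_bound)
    show "0 \<le> 4 * real k / r" using r by simp
    fix y
    show "norm (F i y) \<le> 4 * real k / r * norm y"
    proof (cases "y = 0")
      case False
      \<comment> \<open>Scales \<open>y\<close> to length \<open>r / 2\<close>, so that
        \<open>x + c *\<^sub>R y\<close> stays in the ball. Two values of norm at most
        \<open>k\<close> then give \<open>2 * k / c\<close>, whence the 4 in the bound.\<close>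
      define c where "c = r / (2 * norm y)"
      have c: "c > 0" using False r by (simp add: c_def)
      have "norm (c *\<^sub>R y) < r" using False r by (simp add: c_def)
      then have "x + c *\<^sub>R y \<in> E k" "x \<in> E k"
        using r by (auto simp: subset_iff dist_norm)
      then have "norm (F i (x + c *\<^sub>R y)) \<le> real k" "norm (F i x) \<le> real k"
        using i by (auto simp: E_def)
      moreover have "F i (x + c *\<^sub>R y) - F i x = c *\<^sub>R F i y"
        by (simp add: blinfun.bilinear_simps)
      ultimately have "norm (c *\<^sub>R F i y) \<le> 2 * real k"
        by (metis add_mono mult_2 norm_triangle_ineq4 order_trans)
      then have "norm (F i y) \<le> 2 * real k / c"
        using c by (simp add: field_simps)
      also have "\<dots> = 4 * real k / r * norm y"
        using False r by (simp add: c_def field_simps)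
      finally show ?thesis .
    qed simp
  qed
  then show ?thesis by blast
qed

text \<open>Split \<open>G r (u r)\<close> into \<open>G r (u r - y) + G r y\<close>: the norm bound
  sends the first term to 0, so convergence of \<open>G r\<close> at the single vector
  \<open>y\<close> is enough.\<close>

lemma blinfun_strong_tendsto:
  fixes G :: "'i \<Rightarrow> 'a::real_normed_vector \<Rightarrow>\<^sub>L 'b::real_normed_vector"
  assumes M: "\<forall>\<^sub>F r in F. norm (G r) \<le> M"
    and G: "((\<lambda>r. G r y) \<longlongrightarrow> z) F" and u: "(u \<longlongrightarrow> y) F"
  shows "((\<lambda>r. G r (u r)) \<longlongrightarrow> z) F"
proof -
  have "((\<lambda>r. G r (u r - y)) \<longlongrightarrow> 0) F"
  proof (rule Lim_null_comparison)
    show "\<forall>\<^sub>F r in F. norm (G r (u r - y)) \<le> M * norm (u r - y)"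
      using M by eventually_elim (meson mult_right_mono norm_blinfun norm_ge_zero order_trans)
    have "((\<lambda>r. M * norm (u r - y)) \<longlongrightarrow> M * norm (y - y)) F"
      by (intro tendsto_intros u)
    then show "((\<lambda>r. M * norm (u r - y)) \<longlongrightarrow> 0) F" by simp
  qed
  from tendsto_add[OF this G] show ?thesis by (simp add: blinfun.diff_right)
qed

text \<open>Bridge between the generator, defined by difference quotients, and the calculus of
  derivatives. The signed factor \<open>1 / (r - s)\<close> treats both sides of \<open>s\<close> at
  once.\<close>

lemma has_vector_derivative_iff_quotient:
  "(f has_vector_derivative d) (at s within I) \<longleftrightarrow>
    ((\<lambda>r. (1 / (r - s)) *\<^sub>R (f r - f s)) \<longlongrightarrow> d) (at s within I)"
proof -
  have eq: "norm ((1 / (r - s)) *\<^sub>R (f r - f s) - d) =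
      norm ((1 / norm (r - s)) *\<^sub>R (f r - (f s + (r - s) *\<^sub>R d)))" if "r \<noteq> s" for r
  proof -
    have "(1 / (r - s)) *\<^sub>R (f r - f s) - d = (1 / (r - s)) *\<^sub>R (f r - (f s + (r - s) *\<^sub>R d))"
      using that by (simp add: scaleR_diff_right scaleR_add_right)
    then show ?thesis by simp
  qed
  have "((\<lambda>r. (1 / (r - s)) *\<^sub>R (f r - f s)) \<longlongrightarrow> d) (at s within I) \<longleftrightarrow>
      ((\<lambda>r. norm ((1 / (r - s)) *\<^sub>R (f r - f s) - d)) \<longlongrightarrow> 0) (at s within I)"
    by (simp only: tendsto_norm_zero_iff LIM_zero_iff)
  also have "\<dots> \<longleftrightarrow>
      ((\<lambda>r. norm ((1 / norm (r - s)) *\<^sub>R (f r - (f s + (r - s) *\<^sub>R d)))) \<longlongrightarrow> 0) (at s within I)"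
    by (intro filterlim_cong refl) (auto simp: eventually_at_filter eq)
  finally show ?thesis
    unfolding has_vector_derivative_def has_derivative_within
    by (simp only: tendsto_norm_zero_iff bounded_linear_scaleR_left simp_thms)
qed

text \<open>The bilinear product rule would ask for differentiability of \<open>G\<close> in
  operator norm. Here the quotient is split into \<open>G r\<close> applied to the quotient of
  \<open>y\<close>, plus the quotient of \<open>G\<close> at the fixed vector
  \<open>y s\<close>.\<close>

lemma has_vector_derivative_strong_product:
  fixes G :: "real \<Rightarrow> 'a::real_normed_vector \<Rightarrow>\<^sub>L 'b::real_normed_vector"
  assumes M: "\<forall>\<^sub>F r in at s within I. norm (G r) \<le> M"
    and G': "((\<lambda>r. G r (y s)) has_vector_derivative z) (at s within I)"
    and y': "(y has_vector_derivative y') (at s within I)"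
    and cont: "((\<lambda>r. G r y') \<longlongrightarrow> G s y') (at s within I)"
  shows "((\<lambda>r. G r (y r)) has_vector_derivative (z + G s y')) (at s within I)"
proof -
  have "((\<lambda>r. G r ((1 / (r - s)) *\<^sub>R (y r - y s))) \<longlongrightarrow> G s y') (at s within I)"
    by (rule blinfun_strong_tendsto[OF M cont y'[unfolded has_vector_derivative_iff_quotient]])
  from tendsto_add[OF G'[unfolded has_vector_derivative_iff_quotient] this]
  show ?thesis
    unfolding has_vector_derivative_iff_quotient
    by (simp add: blinfun.bilinear_simps algebra_simps)
qed

lemma integral_has_vector_derivative_atLeast:
  fixes f :: "real \<Rightarrow> 'a::banach"
  assumes "continuous_on {0..} f" "0 \<le> s"
  shows "((\<lambda>u. integral {0..u} f) has_vector_derivative f s) (at s within {0..})"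
proof -
  \<comment> \<open>The endpoint \<open>s + 1\<close> keeps \<open>s\<close> away from the right
    end, so both filters agree.\<close>
  have "at s within {0..} = at s within {0..s+1}"
    using \<open>0 \<le> s\<close> by (intro at_within_nhd[of s "{..<s+1}"]) auto
  moreover have "((\<lambda>u. integral {0..u} f) has_vector_derivative f s) (at s within {0..s+1})"
    using assms by (intro integral_has_vector_derivative continuous_on_subset[OF assms(1)]) auto
  ultimately show ?thesis by simp
qed

lemma nonpos_derivative_imp_le:
  fixes f :: "real \<Rightarrow> real"
  assumes f': "\<And>s. 0 \<le> s \<Longrightarrow> (f has_vector_derivative f' s) (at s within {0..})"
    and neg: "\<And>s. 0 \<le> s \<Longrightarrow> f' s \<le> 0" and t: "0 \<le> t"
  shows "f t \<le> f 0"
proof -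
  have "(f' has_integral (f t - f 0)) {0..t}"
    using t by (intro fundamental_theorem_of_calculus)
      (auto intro: has_vector_derivative_within_subset[OF f'])
  from has_integral_neg[OF this] have "0 \<le> - (f t - f 0)"
    by (rule has_integral_nonneg) (use neg in simp)
  then show ?thesis by simp
qed

section \<open>Evaluating Lyapunov limits on pairs of vectors\<close>

lemma lyapunov_semigroup_apply: "lyapunov_semigroup T t P x y = P (T t x) (T t y)"
  by (simp add: lyapunov_semigroup_def)

text \<open>Only symmetrised tensors are available as test functionals. They suffice, because on a
  symmetric operator such a tensor gives twice the value of the form.\<close>

lemma lyapunov_limit_tendsto:
  assumes P: "P \<in> symmetric_ops" and lim: "lyapunov_limit T P Q"
  shows "((\<lambda>t. 1 / t * (P (T t x) (T t y) - P x y)) \<longlongrightarrow> Q x y) (at_right 0)"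
proof -
  have u: "tensor x y + tensor y x \<in> symmetric_tensors"
    unfolding symmetric_tensors_def by (intro subsetD[OF closure_subset] span_base) blast
  have sym: "P a b = P b a" "Q y x = Q x y" for a b
    using P lim by (auto simp: symmetric_ops_def lyapunov_limit_def limitin_weak_star_iff)
  have "((\<lambda>t. blinfun_apply (tensor x y + tensor y x) ((1 / t) *\<^sub>R (lyapunov_semigroup T t P - P)))
      \<longlongrightarrow> blinfun_apply (tensor x y + tensor y x) Q) (at_right 0)"
    using lim u unfolding lyapunov_limit_def limitin_weak_star_iff by blast
  then have "((\<lambda>t. 2 * (1 / t * (P (T t x) (T t y) - P x y))) \<longlongrightarrow> 2 * Q x y) (at_right 0)"
    by (simp add: blinfun.bilinear_simps lyapunov_semigroup_apply sym(2) sym(1)[of y x]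
        sym(1)[of "T _ y" "T _ x"])
  then show ?thesis by (rule tendsto_mult_left_iff[THEN iffD1, rotated]) simp
qed

lemma lyapunov_generator_eq:
  assumes "lyapunov_limit T P Q"
  shows "lyapunov_generator T P = Q"
  unfolding lyapunov_generator_def
  by (rule the_equality[where P = "lyapunov_limit T P", OF assms])
    (rule lyapunov_limit_unique[OF _ assms])

section \<open>Generators of strongly continuous semigroups\<close>

locale semigroup_generator =
  fixes D :: "'a::banach set" and A :: "'a \<Rightarrow> 'a" and T :: "real \<Rightarrow> 'a \<Rightarrow>\<^sub>L 'a"
  assumes generates: "generates D A T"
begin

lemma T_zero: "T 0 = id_blinfun"
  and T_add: "0 \<le> s \<Longrightarrow> 0 \<le> t \<Longrightarrow> T (s + t) = T s o\<^sub>L T t"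
  and T_tendsto: "((\<lambda>t. T t x) \<longlongrightarrow> x) (at_right 0)"
  using generates by (auto simp: generates_def C0_semigroup_def)

lemma T_add_apply: "0 \<le> s \<Longrightarrow> 0 \<le> t \<Longrightarrow> T (s + t) x = T s (T t x)"
  by (simp add: T_add)

lemma domain_iff: "x \<in> D \<longleftrightarrow> (\<exists>y. ((\<lambda>t. (1 / t) *\<^sub>R (T t x - x)) \<longlongrightarrow> y) (at_right 0))"
  using generates by (auto simp: generates_def)

lemma A_tendsto: "x \<in> D \<Longrightarrow> ((\<lambda>t. (1 / t) *\<^sub>R (T t x - x)) \<longlongrightarrow> A x) (at_right 0)"
  using generates by (auto simp: generates_def)

lemma domainI:
  assumes "((\<lambda>t. (1 / t) *\<^sub>R (T t x - x)) \<longlongrightarrow> y) (at_right 0)"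
  shows "x \<in> D" and "A x = y"
proof -
  show D: "x \<in> D" using assms domain_iff by blast
  show "A x = y"
    using A_tendsto[OF D] assms by (rule tendsto_unique[OF trivial_limit_at_right_real])
qed

section \<open>Growth bounds and strong continuity\<close>

text \<open>Otherwise there are times \<open>t n\<close> tending to 0 with
  \<open>norm (T (t n)) > n\<close>, although every sequence \<open>T (t n) x\<close> converges;
  this contradicts uniform boundedness.\<close>

lemma norm_T_bounded_near_0: "\<exists>\<delta>>0. \<exists>K. \<forall>t\<in>{0..\<delta>}. norm (T t) \<le> K"
proof (rule ccontr)
  assume contr: "\<not> ?thesis"
  have "\<exists>t\<in>{0..inverse (Suc n)}. norm (T t) > real n" for n
  proof (rule ccontr)
    assume "\<not> (\<exists>t\<in>{0..inverse (Suc n)}. norm (T t) > real n)"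
    then have "\<forall>t\<in>{0..inverse (Suc n)}. norm (T t) \<le> real n" by (auto simp: not_less)
    moreover have "inverse (real (Suc n)) > 0" by simp
    ultimately show False using contr by blast
  qed
  then obtain t where t: "\<And>n. t n \<in> {0..inverse (Suc n)}" "\<And>n. norm (T (t n)) > real n"
    by metis
  have lim: "t \<longlonglongrightarrow> 0"
    by (rule tendsto_sandwich[OF _ _ tendsto_const LIMSEQ_inverse_real_of_nat]) (use t(1) in auto)
  have "\<exists>K. \<forall>n\<in>UNIV. norm (T (t n) x) \<le> K" for x
  proof -
    have "continuous (at 0 within {0..}) (\<lambda>t. T t x)"
      using T_tendsto by (simp add: continuous_within T_zero at_within_Ici_at_right)
    then have "(\<lambda>n. T (t n) x) \<longlonglongrightarrow> T 0 x"
      by (rule continuous_within_tendsto_compose'[OF _ _ lim]) (use t(1) in simp)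
    then have "bounded (range (\<lambda>n. T (t n) x))" by (rule convergent_imp_bounded)
    then show ?thesis by (simp add: bounded_iff)
  qed
  then obtain K where K: "\<And>n. norm (T (t n)) \<le> K"
    using uniform_boundedness[of UNIV "\<lambda>n. T (t n)"] by auto
  obtain n where "K \<le> real n" using real_arch_simple by blast
  with K[of n] t(2)[of n] show False by simp
qed

lemma norm_T_bounded_on_interval:
  obtains K where "0 \<le> K" "\<And>t. 0 \<le> t \<Longrightarrow> t \<le> a \<Longrightarrow> norm (T t) \<le> K"
proof -
  obtain \<delta> K where \<delta>: "\<delta> > 0" and K: "\<And>t. t \<in> {0..\<delta>} \<Longrightarrow> norm (T t) \<le> K"
    using norm_T_bounded_near_0 by blast
  have K0: "0 \<le> K" using K[of 0] \<delta> order_trans[OF norm_ge_zero] by auto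
  have "\<exists>L\<ge>0. \<forall>t\<in>{0..real n * \<delta>}. norm (T t) \<le> L" for n
  proof (induction n)
    case 0
    show ?case by (intro exI[of _ "norm (T 0)"]) auto
  next
    case (Suc n)
    then obtain L where L: "0 \<le> L" "\<And>t. t \<in> {0..real n * \<delta>} \<Longrightarrow> norm (T t) \<le> L" by blast
    have "norm (T t) \<le> max L (L * K)" if t: "t \<in> {0..real (Suc n) * \<delta>}" for t
    proof (cases "t \<le> real n * \<delta>")
      case True
      then show ?thesis using L t by (auto intro: max.coboundedI1)
    next
      case False
      \<comment> \<open>The two times add up to \<open>t\<close>, and both are nonnegative even if
        \<open>t < \<delta>\<close>, which occurs for \<open>n = 0\<close>.\<close>
      then have n: "max 0 (t - \<delta>) \<in> {0..real n * \<delta>}" "min \<delta> t \<in> {0..\<delta>}"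
        using t \<delta> by (auto simp: algebra_simps)
      then have "T t = T (max 0 (t - \<delta>)) o\<^sub>L T (min \<delta> t)"
        by (subst T_add[symmetric]) (auto simp: max_def min_def)
      also have "norm \<dots> \<le> norm (T (max 0 (t - \<delta>))) * norm (T (min \<delta> t))"
        by (rule norm_blinfun_compose)
      also have "\<dots> \<le> L * K" by (intro mult_mono L K n) (use L in auto)
      finally show ?thesis by simp
    qed
    then show ?case using L by (intro exI[of _ "max L (L * K)"]) auto
  qed
  moreover obtain n where "a < real n * \<delta>"
    using \<delta> ex_less_of_nat_mult by blast
  ultimately show thesis using that by (metis atLeastAtMost_iff less_imp_le order_trans)
qed

text \<open>Limits from both sides reduce to right continuity at 0: up to sign, the difference is
  \<open>T m (T \<bar>t - s\<bar> x - x)\<close> with \<open>m = min t s\<close>, and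
  \<open>norm (T m)\<close> is bounded near \<open>s\<close>.\<close>

lemma tendsto_T: "0 \<le> s \<Longrightarrow> ((\<lambda>t. T t x) \<longlongrightarrow> T s x) (at s within {0..})"
proof -
  assume s: "0 \<le> s"
  obtain K where K: "0 \<le> K" "\<And>t. 0 \<le> t \<Longrightarrow> t \<le> s + 1 \<Longrightarrow> norm (T t) \<le> K"
    using norm_T_bounded_on_interval by blast
  have c0: "continuous (at 0 within {0..}) (\<lambda>t. T t x)"
    using T_tendsto by (simp add: continuous_within T_zero at_within_Ici_at_right)
  have "((\<lambda>t. \<bar>t - s\<bar>) \<longlongrightarrow> \<bar>s - s\<bar>) (at s within {0..})" by (intro tendsto_intros)
  then have lim: "((\<lambda>t. T \<bar>t - s\<bar> x) \<longlongrightarrow> T 0 x) (at s within {0..})"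
    by (intro continuous_within_tendsto_compose'[OF c0]) auto
  have "((\<lambda>t. T t x - T s x) \<longlongrightarrow> 0) (at s within {0..})"
  proof (rule Lim_null_comparison)
    have "\<forall>\<^sub>F t in at s within {0..}. t \<in> {0..} \<and> dist t s < 1"
      unfolding eventually_at by (intro exI[of _ 1]) auto
    then show "\<forall>\<^sub>F t in at s within {0..}. norm (T t x - T s x) \<le> K * norm (T \<bar>t - s\<bar> x - x)"
    proof eventually_elim
      case (elim t)
      define m where "m = min t s"
      have m: "0 \<le> m" "m \<le> s + 1" using elim s by (auto simp: m_def)
      have *: "T (m + \<bar>t - s\<bar>) x - T m x = T m (T \<bar>t - s\<bar> x - x)"
        using m by (simp add: T_add_apply blinfun.diff_right)
      have "norm (T t x - T s x) = norm (T (m + \<bar>t - s\<bar>) x - T m x)"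
        by (cases "t \<le> s") (simp_all add: m_def norm_minus_commute)
      also have "\<dots> \<le> norm (T m) * norm (T \<bar>t - s\<bar> x - x)"
        unfolding * by (rule norm_blinfun)
      also have "\<dots> \<le> K * norm (T \<bar>t - s\<bar> x - x)"
        by (intro mult_right_mono K m) simp
      finally show ?case .
    qed
    have "((\<lambda>t. K * norm (T \<bar>t - s\<bar> x - x)) \<longlongrightarrow> K * norm (T 0 x - x)) (at s within {0..})"
      by (intro tendsto_intros lim)
    then show "((\<lambda>t. K * norm (T \<bar>t - s\<bar> x - x)) \<longlongrightarrow> 0) (at s within {0..})"
      by (simp add: T_zero)
  qed
  then show ?thesis by (simp add: LIM_zero_iff)
qed

lemma continuous_on_T: "continuous_on {0..} (\<lambda>t. T t x)"
  by (auto simp: continuous_on_def intro: tendsto_T)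

section \<open>The domain of the generator and differentiability of orbits\<close>

text \<open>\<open>T h\<close> shifts the interval of integration by \<open>h\<close>, so in the
  difference only the two end pieces of length \<open>h\<close> survive; divided by \<open>h\<close>
  they tend to \<open>T t x\<close> and \<open>x\<close>.\<close>

lemma integral_in_domain:
  assumes t: "0 \<le> t"
  shows "integral {0..t} (\<lambda>s. T s x) \<in> D"
proof -
  define I where "I u = integral {0..u} (\<lambda>s. T s x)" for u
  have int: "(\<lambda>s. T s x) integrable_on {a..b}" if "0 \<le> a" for a b
    by (intro integrable_continuous_interval continuous_on_subset[OF continuous_on_T])
      (use that in auto)
  have quot: "((\<lambda>h. (1 / h) *\<^sub>R (I (u + h) - I u)) \<longlongrightarrow> T u x) (at_right 0)" if "0 \<le> u" for u
  proof -
    have "((\<lambda>r. (1 / (r - u)) *\<^sub>R (I r - I u)) \<longlongrightarrow> T u x) (at u within {0..})"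
      using integral_has_vector_derivative_atLeast[OF continuous_on_T that]
      unfolding has_vector_derivative_iff_quotient I_def .
    then have "((\<lambda>r. (1 / (r - u)) *\<^sub>R (I r - I u)) \<longlongrightarrow> T u x) (at_right u)"
      by (rule tendsto_within_subset) (use that in auto)
    moreover have "at_right u = filtermap (\<lambda>h. h + u) (at_right 0)"
      by (simp add: filtermap_at_right_shift[of "- u", simplified])
    ultimately show ?thesis by (simp add: filterlim_filtermap add.commute)
  qed
  have shift: "T h (I t) - I t = (I (t + h) - I t) - (I (0 + h) - I 0)" if h: "0 < h" for h
  proof -
    have "T h (I t) = integral {0..t} (\<lambda>s. T h (T s x))"
      unfolding I_def using integral_linear[OF int blinfun.bounded_linear_right, of 0 t "T h"]
      by (simp add: o_def)
    also have "\<dots> = integral {0..t} ((\<lambda>s. T s x) \<circ> (+) h)"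
      by (intro integral_cong) (use h in \<open>simp add: T_add_apply\<close>)
    also have "\<dots> = integral {h..t + h} (\<lambda>s. T s x)"
      by (subst integral_shift_Icc_real) simp
    also have "I h + \<dots> = I (t + h)"
      unfolding I_def by (rule Henstock_Kurzweil_Integration.integral_combine)
        (use h t int in auto)
    finally show ?thesis by (simp add: I_def algebra_simps)
  qed
  have "((\<lambda>h. (1 / h) *\<^sub>R (I (t + h) - I t) - (1 / h) *\<^sub>R (I (0 + h) - I 0))
      \<longlongrightarrow> T t x - T 0 x) (at_right 0)"
    by (intro tendsto_diff quot) (use t in auto)
  moreover have "(1 / h) *\<^sub>R (I (t + h) - I t) - (1 / h) *\<^sub>R (I (0 + h) - I 0) =
      (1 / h) *\<^sub>R (T h (I t) - I t)" if "0 < h" for h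
    unfolding shift[OF that] by (rule scaleR_diff_right[symmetric])
  ultimately have "((\<lambda>h. (1 / h) *\<^sub>R (T h (I t) - I t)) \<longlongrightarrow> T t x - T 0 x) (at_right 0)"
    by (elim Lim_transform_eventually) (rule eventually_mono[OF eventually_at_right_less[of 0]])
  then show ?thesis unfolding I_def by (rule domainI)
qed

lemma domain_scaleR:
  assumes "x \<in> D"
  shows "c *\<^sub>R x \<in> D"
proof -
  have "((\<lambda>t. c *\<^sub>R ((1 / t) *\<^sub>R (T t x - x))) \<longlongrightarrow> c *\<^sub>R A x) (at_right 0)"
    by (intro tendsto_intros A_tendsto assms)
  then show ?thesis
    by (intro domainI(1)[where y = "c *\<^sub>R A x"])
      (simp add: blinfun.scaleR_right scaleR_diff_right mult.commute)
qed

text \<open>The means of an orbit over \<open>{0..h}\<close> lie in \<open>D\<close> and tend to its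
  starting point as \<open>h\<close> tends to 0.\<close>

lemma closure_domain: "closure D = UNIV"
proof (intro set_eqI iffI UNIV_I)
  fix x
  have "((\<lambda>h. (1 / (h - 0)) *\<^sub>R (integral {0..h} (\<lambda>s. T s x) - integral {0..0} (\<lambda>s. T s x)))
      \<longlongrightarrow> T 0 x) (at 0 within {0..})"
    using integral_has_vector_derivative_atLeast[OF continuous_on_T, of 0 x]
    unfolding has_vector_derivative_iff_quotient by simp
  then have "((\<lambda>h. (1 / h) *\<^sub>R integral {0..h} (\<lambda>s. T s x)) \<longlongrightarrow> x) (at_right 0)"
    by (simp add: T_zero at_within_Ici_at_right)
  then show "x \<in> closure D"
    by (rule Lim_in_closed_set[rotated -1])
      (auto intro!: eventually_mono[OF eventually_at_right_less[of 0]]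
        subsetD[OF closure_subset] domain_scaleR integral_in_domain)
qed

lemma T_domain:
  assumes x: "x \<in> D" and s: "0 \<le> s"
  shows "T s x \<in> D" and "A (T s x) = T s (A x)"
proof -
  have lim: "((\<lambda>h. T s ((1 / h) *\<^sub>R (T h x - x))) \<longlongrightarrow> T s (A x)) (at_right 0)"
    by (intro tendsto_intros A_tendsto x)
  have eq: "T s ((1 / h) *\<^sub>R (T h x - x)) = (1 / h) *\<^sub>R (T h (T s x) - T s x)"
    if "0 < h" for h
    using that s by (simp add: blinfun.bilinear_simps add.commute flip: T_add_apply)
  have "((\<lambda>h. (1 / h) *\<^sub>R (T h (T s x) - T s x)) \<longlongrightarrow> T s (A x)) (at_right 0)"
    using lim
    by (rule Lim_transform_eventually)
      (rule eventually_mono[OF eventually_at_right_less[of 0] eq])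
  then show "T s x \<in> D" "A (T s x) = T s (A x)" by (rule domainI)+
qed

text \<open>Factoring out the earlier time turns the quotient into
  \<open>T (min r s) (q \<bar>r - s\<bar>)\<close> on both sides of \<open>s\<close>. From the left
  the operator moves together with its argument, which is why \<open>blinfun_strong_tendsto\<close>
  is needed.\<close>

lemma has_vector_derivative_T:
  assumes x: "x \<in> D" and s: "0 \<le> s"
  shows "((\<lambda>r. T r x) has_vector_derivative T s (A x)) (at s within {0..})"
  unfolding has_vector_derivative_iff_quotient
proof -
  obtain K where K: "\<And>t. 0 \<le> t \<Longrightarrow> t \<le> s \<Longrightarrow> norm (T t) \<le> K"
    using norm_T_bounded_on_interval by blast
  define q where "q h = (1 / h) *\<^sub>R (T h x - x)" for h
  let ?F = "at s within {0..}"
  have ev: "\<forall>\<^sub>F r in ?F. 0 \<le> r \<and> r \<noteq> s"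
    by (auto simp: eventually_at_filter)
  have "filterlim (\<lambda>r. \<bar>r - s\<bar>) (at_right 0) ?F"
    unfolding filterlim_at
  proof
    have "((\<lambda>r. \<bar>r - s\<bar>) \<longlongrightarrow> \<bar>s - s\<bar>) ?F" by (intro tendsto_intros)
    then show "((\<lambda>r. \<bar>r - s\<bar>) \<longlongrightarrow> 0) ?F" by simp
  qed (use ev in \<open>auto elim: eventually_mono\<close>)
  then have q: "((\<lambda>r. q \<bar>r - s\<bar>) \<longlongrightarrow> A x) ?F"
    using A_tendsto[OF x] unfolding q_def by (rule filterlim_compose[rotated])
  have "((\<lambda>r. min r s) \<longlongrightarrow> min s s) ?F" by (intro tendsto_intros)
  then have min: "((\<lambda>r. min r s) \<longlongrightarrow> s) ?F" by simp
  have "continuous (at s within {0..}) (\<lambda>t. T t (A x))"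
    using tendsto_T[OF s] by (simp add: continuous_within)
  then have "((\<lambda>r. T (min r s) (A x)) \<longlongrightarrow> T s (A x)) ?F"
    by (rule continuous_within_tendsto_compose[OF _ _ min])
      (rule eventually_mono[OF ev], use s in simp)
  then have "((\<lambda>r. T (min r s) (q \<bar>r - s\<bar>)) \<longlongrightarrow> T s (A x)) ?F"
    by (rule blinfun_strong_tendsto[rotated, OF _ q])
      (use s in \<open>auto intro!: eventually_mono[OF ev] K\<close>)
  then show "((\<lambda>r. (1 / (r - s)) *\<^sub>R (T r x - T s x)) \<longlongrightarrow> T s (A x)) ?F"
  proof (rule Lim_transform_eventually)
    show "\<forall>\<^sub>F r in ?F. T (min r s) (q \<bar>r - s\<bar>) = (1 / (r - s)) *\<^sub>R (T r x - T s x)"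
      using ev
    proof eventually_elim
      case (elim r)
      have "T (min r s) (q \<bar>r - s\<bar>) = (1 / \<bar>r - s\<bar>) *\<^sub>R (T (min r s + \<bar>r - s\<bar>) x - T (min r s) x)"
        using elim s by (simp add: q_def blinfun.bilinear_simps T_add_apply)
      also have "\<dots> = (1 / (r - s)) *\<^sub>R (T r x - T s x)"
      proof (cases "r \<le> s")
        case True
        then have "(1 / (s - r)) *\<^sub>R (T s x - T r x) = (1 / - (r - s)) *\<^sub>R (- (T r x - T s x))"
          by simp
        also have "\<dots> = (1 / (r - s)) *\<^sub>R (T r x - T s x)"
          by (simp only: divide_minus_right scaleR_minus_left scaleR_minus_right minus_minus)
        finally show ?thesis using True by (simp add: min_def)
      qed (simp add: min_def)
      finally show ?case .
    qed
  qed
qed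

section \<open>The Lyapunov equation as an identity of forms on the domain\<close>

lemma has_vector_derivative_quadratic:
  fixes P :: "'a \<Rightarrow>\<^sub>L 'a \<Rightarrow>\<^sub>L real"
  assumes "x \<in> D" "y \<in> D" "0 \<le> s"
  shows "((\<lambda>r. P (T r x) (T r y)) has_vector_derivative
    P (T s x) (A (T s y)) + P (A (T s x)) (T s y)) (at s within {0..})"
  using bounded_bilinear.has_vector_derivative[OF bounded_bilinear_blinfun_apply
      bounded_linear.has_vector_derivative[OF blinfun.bounded_linear_right
        has_vector_derivative_T[OF assms(1,3)], of P]
      has_vector_derivative_T[OF assms(2,3)]]
  by (simp add: T_domain assms)

lemma blinfun_eqI_domain:
  fixes F G :: "'a \<Rightarrow>\<^sub>L 'b::real_normed_vector"
  assumes "\<And>x. x \<in> D \<Longrightarrow> F x = G x"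
  shows "F = G"
proof (rule blinfun_eqI)
  fix x
  have "closed {x. F x = G x}"
    by (intro closed_Collect_eq continuous_intros)
  with assms have "closure D \<subseteq> {x. F x = G x}"
    by (intro closure_minimal) auto
  then show "F x = G x" using closure_domain by auto
qed

lemma norm_blinfun_bound_domain:
  fixes F :: "'a \<Rightarrow>\<^sub>L 'b::real_normed_vector"
  assumes "0 \<le> K" "\<And>x. x \<in> D \<Longrightarrow> norm (F x) \<le> K * norm x"
  shows "norm F \<le> K"
proof (rule norm_blinfun_bound[OF assms(1)])
  fix x
  have "closed {x. norm (F x) \<le> K * norm x}"
    by (intro closed_Collect_le continuous_intros)
  with assms(2) have "closure D \<subseteq> {x. norm (F x) \<le> K * norm x}"
    by (intro closure_minimal) auto
  then show "norm (F x) \<le> K * norm x" using closure_domain by auto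
qed

lemma banach_adjoint_eq:
  assumes "\<And>y. y \<in> D \<Longrightarrow> blinfun_apply f (A y) = blinfun_apply g y"
  shows "banach_adjoint D A f = g"
  unfolding banach_adjoint_def
proof (rule the_equality)
  fix h :: "'a \<Rightarrow>\<^sub>L real"
  assume "\<forall>x\<in>D. f (A x) = h x"
  then show "h = g" using assms by (intro blinfun_eqI_domain) auto
qed (use assms in blast)

text \<open>Removes the adjoint, leaving an identity that can be integrated along orbits. The
  inclusion in the adjoint domain comes for free from it: it exhibits
  \<open>y \<mapsto> P x (A y)\<close> on \<open>D\<close> as the bounded functional
  \<open>R x - P (A x)\<close>.\<close>

lemma lyapunov_equation_iff:
  fixes P R :: "'a \<Rightarrow>\<^sub>L 'a \<Rightarrow>\<^sub>L real"
  shows "P ` D \<subseteq> adjoint_domain D A \<and> (\<forall>x\<in>D. banach_adjoint D A (P x) + P (A x) = R x) \<longleftrightarrow>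
    (\<forall>x\<in>D. \<forall>y\<in>D. P x (A y) + P (A x) y = R x y)"
proof (intro iffI conjI ballI subsetI)
  fix x y assume eq: "P ` D \<subseteq> adjoint_domain D A \<and>
      (\<forall>x\<in>D. banach_adjoint D A (P x) + P (A x) = R x)" and x: "x \<in> D" and y: "y \<in> D"
  then obtain g where g: "\<And>y. y \<in> D \<Longrightarrow> P x (A y) = blinfun_apply g y"
    unfolding adjoint_domain_def by blast
  then have "R x = g + P (A x)" using eq x banach_adjoint_eq by metis
  then show "P x (A y) + P (A x) y = R x y"
    using g[OF y] by (simp add: blinfun.add_left)
next
  assume eq: "\<forall>x\<in>D. \<forall>y\<in>D. P x (A y) + P (A x) y = R x y"
  have adj: "P x (A y) = blinfun_apply (R x - P (A x)) y" if "x \<in> D" "y \<in> D" for x y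
  proof -
    have "P x (A y) + P (A x) y = R x y" using eq that by blast
    then show ?thesis by (simp add: blinfun.diff_left)
  qed
  show "f \<in> adjoint_domain D A" if "f \<in> P ` D" for f
    using that adj unfolding adjoint_domain_def by blast
  show "banach_adjoint D A (P x) + P (A x) = R x" if "x \<in> D" for x
    using banach_adjoint_eq[OF adj[OF that]] by simp
qed

text \<open>One quotient, two limits: the weak* limit tested on tensors, and the derivative at 0 of
  the form along orbits.\<close>

lemma lyapunov_limit_on_domain:
  assumes P: "P \<in> symmetric_ops" and lim: "lyapunov_limit T P Q" and x: "x \<in> D" and y: "y \<in> D"
  shows "P x (A y) + P (A x) y = Q x y"
proof -
  have "((\<lambda>t. 1 / t * (P (T t x) (T t y) - P x y)) \<longlongrightarrow> Q x y) (at_right 0)"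
    by (rule lyapunov_limit_tendsto[OF P lim])
  moreover have "((\<lambda>t. 1 / t * (P (T t x) (T t y) - P x y)) \<longlongrightarrow> P x (A y) + P (A x) y) (at_right 0)"
    using has_vector_derivative_quadratic[OF x y order_refl, of P]
    by (simp add: has_vector_derivative_iff_quotient T_zero at_within_Ici_at_right)
  ultimately show ?thesis
    by (rule tendsto_unique[OF trivial_limit_at_right_real, rotated])
qed

section \<open>Datko's criterion for exponential stability\<close>

lemma exponentially_stableI:
  assumes N: "\<And>t. 0 \<le> t \<Longrightarrow> norm (T t) \<le> N" and \<tau>: "0 < \<tau>" and half: "norm (T \<tau>) \<le> 1 / 2"
  shows "exponentially_stable T"
proof -
  have iter: "norm (T (real n * \<tau> + t)) \<le> (1 / 2) ^ n * N" if t: "0 \<le> t" for n t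
  proof (induction n)
    case 0
    show ?case using N t by simp
  next
    case (Suc n)
    have "T (real (Suc n) * \<tau> + t) = T (\<tau> + (real n * \<tau> + t))"
      by (simp add: algebra_simps)
    also have "\<dots> = T \<tau> o\<^sub>L T (real n * \<tau> + t)"
      using \<tau> t by (intro T_add) auto
    also have "norm \<dots> \<le> norm (T \<tau>) * norm (T (real n * \<tau> + t))"
      by (rule norm_blinfun_compose)
    also have "\<dots> \<le> 1 / 2 * ((1 / 2) ^ n * N)"
      by (intro mult_mono half Suc) auto
    finally show ?case by simp
  qed
  have N0: "0 \<le> N" using N[of 0] order_trans[OF norm_ge_zero] by auto
  \<comment> \<open>Halving over each period \<open>\<tau>\<close> gives the rate
    \<open>ln 2 / \<tau>\<close>. The factor 2 pays for rounding \<open>t / \<tau>\<close> down to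
    an integer; the summand 1 makes the constant positive.\<close>
  have "norm (T t) \<le> (2 * N + 1) * exp (- (ln 2 / \<tau>) * t)" if t: "0 \<le> t" for t
  proof -
    define n where "n = nat \<lfloor>t / \<tau>\<rfloor>"
    have n: "real n \<le> t / \<tau>" "t / \<tau> < real n + 1"
      using t \<tau> by (simp_all add: n_def)
    have "norm (T t) \<le> (1 / 2) ^ n * N"
      using iter[of "t - real n * \<tau>" n] n \<tau> by (simp add: field_simps)
    also have "(1 / 2 :: real) ^ n = exp (- ln 2 * real n)"
      unfolding exp_of_nat2_mult by (simp add: exp_minus inverse_eq_divide)
    also have "\<dots> \<le> exp (ln 2 - ln 2 * (t / \<tau>))"
      using mult_left_mono[of "t / \<tau>" "real n + 1" "ln 2"] n by (simp add: algebra_simps)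
    also have "\<dots> = 2 * exp (- (ln 2 / \<tau>) * t)"
      by (simp add: exp_diff exp_minus divide_inverse)
    finally have "norm (T t) \<le> 2 * exp (- (ln 2 / \<tau>) * t) * N"
      using N0 by (simp add: mult_right_mono)
    then show ?thesis by (simp add: algebra_simps add_increasing)
  qed
  then show ?thesis
    unfolding exponentially_stable_def
    by (intro exI[of _ "2 * N + 1"] conjI exI[of _ "ln 2 / \<tau>"]) (use N0 \<tau> in auto)
qed

text \<open>By the semigroup law \<open>norm (T t x) \<le> N * norm (T s x)\<close> for all
  \<open>s\<close> up to \<open>t\<close>. Integrating the squares over \<open>s\<close> bounds
  \<open>t * (norm (T t x))\<^sup>2\<close> independently of \<open>t\<close>, so
  \<open>norm (T t)\<close> is small for large \<open>t\<close>.\<close>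

lemma square_integrable_imp_exponentially_stable:
  assumes N: "\<And>t. 0 \<le> t \<Longrightarrow> norm (T t) \<le> N"
    and K: "\<And>t x. 0 \<le> t \<Longrightarrow> x \<in> D \<Longrightarrow> integral {0..t} (\<lambda>s. (norm (T s x))\<^sup>2) \<le> K * (norm x)\<^sup>2"
    and "0 \<le> K"
  shows "exponentially_stable T"
proof -
  \<comment> \<open>Makes \<open>N\<^sup>2 * K / t\<close> at most \<open>1 / 4\<close>, the square
    of the contraction factor \<open>1 / 2\<close>; the summand 1 keeps \<open>t\<close>
    positive.\<close>
  define t where "t = 4 * N\<^sup>2 * K + 1"
  have t: "0 < t" "N\<^sup>2 * K \<le> t / 4"
    using \<open>0 \<le> K\<close> by (simp_all add: t_def add_nonneg_pos)
  have "norm (T t x) \<le> 1 / 2 * norm x" if x: "x \<in> D" for x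
  proof -
    have int: "(\<lambda>s. N\<^sup>2 * (norm (T s x))\<^sup>2) integrable_on {0..t}"
      by (intro integrable_continuous_interval continuous_intros
          continuous_on_subset[OF continuous_on_T]) auto
    have "t * (norm (T t x))\<^sup>2 = integral {0..t} (\<lambda>s. (norm (T t x))\<^sup>2)"
      using t by simp
    also have "\<dots> \<le> integral {0..t} (\<lambda>s. N\<^sup>2 * (norm (T s x))\<^sup>2)"
    proof (rule integral_le[OF _ int])
      fix s assume s: "s \<in> {0..t}"
      then have "T t x = T (t - s) (T s x)"
        using T_add_apply[of "t - s" s x] by simp
      also have "norm \<dots> \<le> norm (T (t - s)) * norm (T s x)" by (rule norm_blinfun)
      also have "\<dots> \<le> N * norm (T s x)" using N s by (intro mult_right_mono) auto
      finally show "(norm (T t x))\<^sup>2 \<le> N\<^sup>2 * (norm (T s x))\<^sup>2"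
        by (metis norm_ge_zero power_mono power_mult_distrib)
    qed (rule integrable_const_ivl)
    also have "\<dots> = N\<^sup>2 * integral {0..t} (\<lambda>s. (norm (T s x))\<^sup>2)" by simp
    also have "\<dots> \<le> N\<^sup>2 * (K * (norm x)\<^sup>2)"
      using K x t by (intro mult_left_mono) auto
    also have "\<dots> \<le> t / 4 * (norm x)\<^sup>2"
      using mult_right_mono[OF t(2), of "(norm x)\<^sup>2"] by (simp add: mult.assoc)
    also have "\<dots> = t * (1 / 2 * norm x)\<^sup>2" by (simp add: power2_eq_square)
    finally have "(norm (T t x))\<^sup>2 \<le> (1 / 2 * norm x)\<^sup>2" using t(1) by simp
    then show ?thesis by (rule power2_le_imp_le) simp
  qed
  then have "norm (T t) \<le> 1 / 2" by (intro norm_blinfun_bound_domain) auto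
  with N t(1) show ?thesis by (intro exponentially_stableI)
qed

end

section \<open>Detectability\<close>

text \<open>The convolution in the variation of constants formula is majorised by the solution
  \<open>w\<close> of \<open>w' = - \<epsilon> * w + v\<close>, \<open>w 0 = 0\<close>. An energy
  argument with the Lyapunov function then replaces Young's inequality and bounds \<open>w\<close>
  and the integral of \<open>w\<^sup>2\<close> at once. The first bound makes \<open>T\<close>
  bounded, the second makes its orbits square integrable: the two inputs of Datko's
  criterion.\<close>

lemma lyapunov_equation_imp_exponentially_stable:
  fixes C :: "'a::banach \<Rightarrow>\<^sub>L 'v::{real_inner,complete_space}"
  assumes gen: "generates D A T" and det: "exponentially_detectable C D A"
    and P: "P \<in> positive_ops"
    and eq: "\<And>x y. x \<in> D \<Longrightarrow> y \<in> D \<Longrightarrow> P x (A y) + P (A x) y = - (C x \<bullet> C y)"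
  shows "exponentially_stable T"
proof -
  obtain L S where genS: "generates D (\<lambda>x. A x - blinfun_apply L (C x)) S"
    and "exponentially_stable S"
    using det unfolding exponentially_detectable_def by blast
  then obtain M \<epsilon> where M: "0 < M" and \<epsilon>: "0 < \<epsilon>"
    and S: "\<And>t. 0 \<le> t \<Longrightarrow> norm (S t) \<le> M * exp (- \<epsilon> * t)"
    unfolding exponentially_stable_def by blast
  interpret T: semigroup_generator D A T by unfold_locales (rule gen)
  interpret S: semigroup_generator D "\<lambda>x. A x - L (C x)" S by unfold_locales (rule genS)
  define p where "p = norm P"
  have p: "0 \<le> p" by (simp add: p_def)
  \<comment> \<open>Relative to \<open>(norm x)\<^sup>2\<close>, \<open>p / \<epsilon>\<close>
    bounds \<open>w\<^sup>2\<close> and \<open>p / \<epsilon>\<^sup>2\<close> bounds its integral.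
    The factors 2 come from \<open>(a + b)\<^sup>2 \<le> 2 * a\<^sup>2 + 2 * b\<^sup>2\<close>, and
    \<open>M\<^sup>2 / \<epsilon>\<close> is the integral of
    \<open>2 * M\<^sup>2 * exp (- (2 * \<epsilon>) * s)\<close> over \<open>{0..}\<close>.\<close>
  define K where "K = M\<^sup>2 / \<epsilon> + 2 * (M * norm L)\<^sup>2 * (p / \<epsilon>\<^sup>2)"
  define N2 where "N2 = 2 * M\<^sup>2 + 2 * (M * norm L)\<^sup>2 * (p / \<epsilon>)"
  have key: "(norm (T t x))\<^sup>2 \<le> N2 * (norm x)\<^sup>2 \<and>
      integral {0..t} (\<lambda>s. (norm (T s x))\<^sup>2) \<le> K * (norm x)\<^sup>2"
    if x: "x \<in> D" and t: "0 \<le> t" for x t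
  proof -
    define v where "v s = norm (C (T s x))" for s
    have cont_v: "continuous_on {0..} v"
      unfolding v_def by (intro continuous_intros T.continuous_on_T)
    \<comment> \<open>\<open>w u\<close> is the integral of
      \<open>exp (- \<epsilon> * (u - s)) * v s\<close> over \<open>{0..u}\<close>. Pulling
      \<open>exp (- \<epsilon> * u)\<close> out leaves an integrand free of \<open>u\<close>, so
      \<open>w\<close> is differentiated by the ordinary product rule.\<close>
    define W where "W u = integral {0..u} (\<lambda>s. exp (\<epsilon> * s) * v s)" for u
    define w where "w u = exp (- \<epsilon> * u) * W u" for u
    have W': "(W has_vector_derivative exp (\<epsilon> * s) * v s) (at s within {0..})" if "0 \<le> s" for s
      unfolding W_def using that
      by (intro integral_has_vector_derivative_atLeast continuous_intros cont_v)
    have w': "(w has_real_derivative - \<epsilon> * w s + v s) (at s within {0..})" if "0 \<le> s" for s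
    proof -
      have "(w has_real_derivative
          exp (- \<epsilon> * s) * (- \<epsilon>) * W s + exp (\<epsilon> * s) * v s * exp (- \<epsilon> * s)) (at s within {0..})"
        unfolding w_def
        by (rule DERIV_mult W'[OF that, folded has_real_derivative_iff_has_vector_derivative]
            derivative_eq_intros refl | simp)+
      also have "exp (- \<epsilon> * s) * (- \<epsilon>) * W s + exp (\<epsilon> * s) * v s * exp (- \<epsilon> * s) =
          - \<epsilon> * w s + v s * (exp (\<epsilon> * s) * exp (- \<epsilon> * s))"
        by (simp add: w_def)
      also have "exp (\<epsilon> * s) * exp (- \<epsilon> * s) = 1"
        by (simp flip: exp_add)
      finally show ?thesis by simp
    qed
    have cont_w: "continuous_on {0..} w"
      by (rule DERIV_continuous_on[OF w']) simp
    define U where "U u = integral {0..u} (\<lambda>s. (w s)\<^sup>2)" for u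
    have U': "(U has_real_derivative (w s)\<^sup>2) (at s within {0..})" if "0 \<le> s" for s
      unfolding U_def has_real_derivative_iff_has_vector_derivative using that
      by (intro integral_has_vector_derivative_atLeast continuous_intros cont_w)
    define \<phi> where "\<phi> s = P (T s x) (T s x)" for s
    have \<phi>': "(\<phi> has_real_derivative - (v s)\<^sup>2) (at s within {0..})" if "0 \<le> s" for s
    proof -
      have "- (v s)\<^sup>2 = P (T s x) (A (T s x)) + P (A (T s x)) (T s x)"
        using eq[OF T.T_domain(1) T.T_domain(1), OF x that x that]
        by (simp add: v_def power2_norm_eq_inner)
      then show ?thesis
        unfolding \<phi>_def has_real_derivative_iff_has_vector_derivative
        using T.has_vector_derivative_quadratic[OF x x that, of P] by simp
    qed
    have "\<phi> 0 \<le> p * norm x * norm x"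
    proof -
      have "\<phi> 0 \<le> norm (P x x)" by (simp add: \<phi>_def T.T_zero)
      also have "\<dots> \<le> norm (P x) * norm x" by (rule norm_blinfun)
      also have "\<dots> \<le> p * norm x * norm x"
        unfolding p_def by (intro mult_right_mono norm_blinfun) simp
      finally show ?thesis .
    qed
    then have \<phi>0: "\<phi> 0 \<le> p * (norm x)\<^sup>2" by (simp add: power2_eq_square)
    \<comment> \<open>\<open>w\<^sup>2 + \<epsilon> U + \<phi> / \<epsilon>\<close> is nonincreasing: its derivative is \<open>- (\<epsilon> w - v)\<^sup>2 / \<epsilon>\<close>.\<close>
    have bound: "(w s)\<^sup>2 + \<epsilon> * U s \<le> p * (norm x)\<^sup>2 / \<epsilon>" if s: "0 \<le> s" for s
    proof -
      define G where "G s = (w s)\<^sup>2 + \<epsilon> * U s + \<phi> s / \<epsilon>" for s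
      have "G s \<le> G 0"
      proof (rule nonpos_derivative_imp_le[OF _ _ s])
        fix r :: real assume r: "0 \<le> r"
        have "(G has_real_derivative
            2 * (- \<epsilon> * w r + v r) * w r + \<epsilon> * (w r)\<^sup>2 + - (v r)\<^sup>2 / \<epsilon>) (at r within {0..})"
          unfolding G_def
          by (rule DERIV_cong[OF DERIV_add[OF DERIV_add[OF DERIV_power[OF w'[OF r], of 2]
                DERIV_cmult[OF U'[OF r]]] DERIV_cdivide[OF \<phi>'[OF r]]]]) simp
        also have "2 * (- \<epsilon> * w r + v r) * w r + \<epsilon> * (w r)\<^sup>2 + - (v r)\<^sup>2 / \<epsilon> =
            - ((\<epsilon> * w r - v r)\<^sup>2 / \<epsilon>)"
          using \<epsilon> by (simp add: field_simps power2_eq_square)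
        finally show "(G has_vector_derivative - ((\<epsilon> * w r - v r)\<^sup>2 / \<epsilon>)) (at r within {0..})"
          by (simp add: has_real_derivative_iff_has_vector_derivative)
        show "- ((\<epsilon> * w r - v r)\<^sup>2 / \<epsilon>) \<le> 0" using \<epsilon> by simp
      qed
      also have "G 0 = \<phi> 0 / \<epsilon>" by (simp add: G_def w_def W_def U_def)
      also have "\<dots> \<le> p * (norm x)\<^sup>2 / \<epsilon>" using \<phi>0 \<epsilon> by (simp add: divide_right_mono)
      finally have "G s \<le> p * (norm x)\<^sup>2 / \<epsilon>" .
      moreover have "0 \<le> \<phi> s / \<epsilon>" using P \<epsilon> by (simp add: \<phi>_def positive_ops_def)
      ultimately show ?thesis unfolding G_def by linarith
    qed
    have U0: "0 \<le> U s" if "0 \<le> s" for s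
      unfolding U_def by (intro integral_nonneg integrable_continuous_interval continuous_intros
          continuous_on_subset[OF cont_w]) auto
    have w_le: "(w s)\<^sup>2 \<le> p * (norm x)\<^sup>2 / \<epsilon>" if "0 \<le> s" for s
      using bound[OF that] mult_nonneg_nonneg[OF less_imp_le[OF \<epsilon>] U0[OF that]] by linarith
    have U_le: "U s \<le> p / \<epsilon>\<^sup>2 * (norm x)\<^sup>2" if "0 \<le> s" for s
    proof -
      have "\<epsilon> * U s \<le> p * (norm x)\<^sup>2 / \<epsilon>"
        using bound[OF that] zero_le_power2[of "w s"] by linarith
      then show ?thesis using \<epsilon> by (simp add: field_simps power2_eq_square)
    qed
    have voc: "norm (T s x) \<le> M * exp (- \<epsilon> * s) * norm x + M * norm L * w s" if s: "0 \<le> s" for s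
    proof -
      \<comment> \<open>\<open>g\<close> is the derivative of \<open>S (s - r) (T r x)\<close> in
        \<open>r\<close>. Both generators have the domain \<open>D\<close>, so the orbit of
        \<open>x\<close> is admissible for both; the terms with \<open>A\<close> cancel and only
        \<open>L\<close> applied to \<open>C (T r x)\<close> is left.\<close>
      define g where "g r = S (s - r) (L (C (T r x)))" for r
      have deriv: "((\<lambda>r. S (s - r) (T r x)) has_vector_derivative g r) (at r within {0..s})"
        if r: "r \<in> {0..s}" for r
      proof -
        have dom: "T r x \<in> D" using T.T_domain(1) x r by simp
        let ?B = "\<lambda>x. A x - L (C x)"
        have flip: "((\<lambda>r. s - r) has_vector_derivative - 1) (at r within {0..s})"
          by (auto intro!: derivative_eq_intros)
        have sub: "(\<lambda>r. s - r) ` {0..s} \<subseteq> {0..}" by auto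
        have "((\<lambda>u. S u (T r x)) has_vector_derivative S (s - r) (?B (T r x)))
            (at (s - r) within (\<lambda>r. s - r) ` {0..s})"
          using r by (intro has_vector_derivative_within_subset[OF S.has_vector_derivative_T[OF dom] sub]) auto
        from vector_diff_chain_within[OF flip this]
        have "((\<lambda>u. S (s - u) (T r x)) has_vector_derivative - S (s - r) (?B (T r x)))
            (at r within {0..s})"
          by (simp add: o_def)
        moreover have "((\<lambda>r. T r x) has_vector_derivative A (T r x)) (at r within {0..s})"
        proof (rule has_vector_derivative_within_subset)
          show "((\<lambda>r. T r x) has_vector_derivative A (T r x)) (at r within {0..})"
            using T.has_vector_derivative_T[OF x, of r] T.T_domain(2)[OF x, of r] r by simp
        qed auto
        moreover have "\<forall>\<^sub>F u in at r within {0..s}. norm (S (s - u)) \<le> M"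
        proof -
          have "norm (S (s - u)) \<le> M" if "u \<in> {0..s}" for u
          proof -
            have "norm (S (s - u)) \<le> M * exp (- \<epsilon> * (s - u))" using S that by simp
            also have "\<dots> \<le> M * 1" using M \<epsilon> that by (intro mult_left_mono) auto
            finally show ?thesis by simp
          qed
          then show ?thesis by (auto simp: eventually_at_filter)
        qed
        moreover have "((\<lambda>u. S (s - u) y) \<longlongrightarrow> S (s - r) y) (at r within {0..s})" for y
        proof -
          have "continuous_on {0..s} (\<lambda>u. S (s - u) y)"
            by (intro continuous_on_compose2[OF S.continuous_on_T] continuous_intros) auto
          then show ?thesis using r by (simp add: continuous_on_def)
        qed
        ultimately have "((\<lambda>r. S (s - r) (T r x)) has_vector_derivative
            - S (s - r) (?B (T r x)) + S (s - r) (A (T r x))) (at r within {0..s})"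
          by (intro has_vector_derivative_strong_product[where G = "\<lambda>u. S (s - u)"]) auto
        then show ?thesis by (simp add: g_def blinfun.diff_right)
      qed
      have int: "(g has_integral (S 0 (T s x) - S s x)) {0..s}"
        using fundamental_theorem_of_calculus[OF s deriv] by (simp add: T.T_zero)
      have "norm (S 0 (T s x) - S s x) \<le>
          integral {0..s} (\<lambda>r. M * norm L * exp (- \<epsilon> * s) * (exp (\<epsilon> * r) * v r))"
        unfolding integral_unique[OF int, symmetric]
      proof (rule integral_norm_bound_integral)
        show "g integrable_on {0..s}" using int by blast
        show "(\<lambda>r. M * norm L * exp (- \<epsilon> * s) * (exp (\<epsilon> * r) * v r)) integrable_on {0..s}"
          by (intro integrable_continuous_interval continuous_intros
              continuous_on_subset[OF cont_v]) auto
        fix r assume r: "r \<in> {0..s}"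
        have "norm (g r) \<le> norm (S (s - r)) * norm (L (C (T r x)))"
          unfolding g_def by (rule norm_blinfun)
        also have "\<dots> \<le> (M * exp (- \<epsilon> * (s - r))) * (norm L * v r)"
          unfolding v_def using S[of "s - r"] r M by (intro mult_mono norm_blinfun) auto
        also have "exp (- \<epsilon> * (s - r)) = exp (- \<epsilon> * s) * exp (\<epsilon> * r)"
          by (simp add: algebra_simps flip: exp_add)
        finally show "norm (g r) \<le> M * norm L * exp (- \<epsilon> * s) * (exp (\<epsilon> * r) * v r)"
          by (simp add: mult_ac)
      qed
      also have "\<dots> = M * norm L * w s" by (simp add: w_def W_def)
      finally have "norm (T s x - S s x) \<le> M * norm L * w s" by (simp add: S.T_zero)
      moreover have "norm (S s x) \<le> M * exp (- \<epsilon> * s) * norm x"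
        using S[OF s] by (meson mult_right_mono norm_blinfun norm_ge_zero order_trans)
      ultimately show ?thesis
        using norm_triangle_ineq[of "T s x - S s x" "S s x"] by simp
    qed
    have sq: "(norm (T s x))\<^sup>2 \<le> 2 * M\<^sup>2 * exp (- (2 * \<epsilon>) * s) * (norm x)\<^sup>2 + 2 * (M * norm L)\<^sup>2 * (w s)\<^sup>2"
      if s: "0 \<le> s" for s
    proof -
      let ?a = "M * exp (- \<epsilon> * s) * norm x" and ?b = "M * norm L * w s"
      have "(norm (T s x))\<^sup>2 \<le> (?a + ?b)\<^sup>2" using voc[OF s] by (intro power_mono) auto
      also have "\<dots> \<le> 2 * ?a\<^sup>2 + 2 * ?b\<^sup>2"
        using zero_le_power2[of "?a - ?b"] by (simp add: power2_sum power2_diff)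
      also have "?a\<^sup>2 = M\<^sup>2 * exp (- (2 * \<epsilon>) * s) * (norm x)\<^sup>2"
        by (simp add: power_mult_distrib flip: exp_double)
      finally show ?thesis by (simp add: power_mult_distrib)
    qed
    have "(norm (T t x))\<^sup>2 \<le> N2 * (norm x)\<^sup>2"
    proof -
      note sq[OF t]
      also have "2 * M\<^sup>2 * exp (- (2 * \<epsilon>) * t) * (norm x)\<^sup>2 + 2 * (M * norm L)\<^sup>2 * (w t)\<^sup>2 \<le>
          2 * M\<^sup>2 * 1 * (norm x)\<^sup>2 + 2 * (M * norm L)\<^sup>2 * (p * (norm x)\<^sup>2 / \<epsilon>)"
        using \<epsilon> t w_le[OF t] by (intro add_mono mult_left_mono mult_right_mono) auto
      finally show ?thesis by (simp add: N2_def algebra_simps)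
    qed
    moreover have "integral {0..t} (\<lambda>s. (norm (T s x))\<^sup>2) \<le> K * (norm x)\<^sup>2"
    proof -
      \<comment> \<open>Integrates the estimate \<open>sq\<close> by monotonicity: from the integral
        of \<open>(norm (T s x))\<^sup>2\<close>, \<open>J\<close> subtracts, up to a constant, an
        antiderivative of the right-hand side of \<open>sq\<close>, so its derivative is at most
        0.\<close>
      define J where "J u = integral {0..u} (\<lambda>s. (norm (T s x))\<^sup>2)
        + M\<^sup>2 / \<epsilon> * (norm x)\<^sup>2 * exp (- (2 * \<epsilon>) * u) - 2 * (M * norm L)\<^sup>2 * U u" for u
      have "J t \<le> J 0"
      proof (rule nonpos_derivative_imp_le[OF _ _ t])
        fix r :: real assume r: "0 \<le> r"
        have *: "((\<lambda>u. integral {0..u} (\<lambda>s. (norm (T s x))\<^sup>2)) has_real_derivative (norm (T r x))\<^sup>2)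
            (at r within {0..})"
          unfolding has_real_derivative_iff_has_vector_derivative using r
          by (intro integral_has_vector_derivative_atLeast continuous_intros T.continuous_on_T)
        have "(J has_real_derivative (norm (T r x))\<^sup>2
            + M\<^sup>2 / \<epsilon> * (norm x)\<^sup>2 * (- (2 * \<epsilon>) * exp (- (2 * \<epsilon>) * r))
            - 2 * (M * norm L)\<^sup>2 * (w r)\<^sup>2) (at r within {0..})"
          unfolding J_def
          by (rule derivative_eq_intros * U'[OF r] refl | simp)+
        then show "(J has_vector_derivative (norm (T r x))\<^sup>2
            + M\<^sup>2 / \<epsilon> * (norm x)\<^sup>2 * (- (2 * \<epsilon>) * exp (- (2 * \<epsilon>) * r))
            - 2 * (M * norm L)\<^sup>2 * (w r)\<^sup>2) (at r within {0..})"
          by (simp add: has_real_derivative_iff_has_vector_derivative)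
        have "M\<^sup>2 / \<epsilon> * (norm x)\<^sup>2 * (- (2 * \<epsilon>) * exp (- (2 * \<epsilon>) * r)) =
            - (2 * M\<^sup>2 * exp (- (2 * \<epsilon>) * r) * (norm x)\<^sup>2)"
          using \<epsilon> by simp
        with sq[OF r] show "(norm (T r x))\<^sup>2
            + M\<^sup>2 / \<epsilon> * (norm x)\<^sup>2 * (- (2 * \<epsilon>) * exp (- (2 * \<epsilon>) * r))
            - 2 * (M * norm L)\<^sup>2 * (w r)\<^sup>2 \<le> 0"
          by linarith
      qed
      then have "integral {0..t} (\<lambda>s. (norm (T s x))\<^sup>2) +
          M\<^sup>2 / \<epsilon> * (norm x)\<^sup>2 * exp (- (2 * \<epsilon>) * t) \<le>
          M\<^sup>2 / \<epsilon> * (norm x)\<^sup>2 + 2 * (M * norm L)\<^sup>2 * U t"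
        by (simp add: J_def U_def)
      moreover have "0 \<le> M\<^sup>2 / \<epsilon> * (norm x)\<^sup>2 * exp (- (2 * \<epsilon>) * t)" using \<epsilon> by simp
      moreover have "2 * (M * norm L)\<^sup>2 * U t \<le> 2 * (M * norm L)\<^sup>2 * (p / \<epsilon>\<^sup>2 * (norm x)\<^sup>2)"
        using U_le[OF t] by (intro mult_left_mono) auto
      ultimately show ?thesis by (simp add: K_def distrib_right mult.assoc)
    qed
    ultimately show ?thesis ..
  qed
  have N2: "0 \<le> N2" using \<epsilon> p by (simp add: N2_def)
  have "norm (T t) \<le> sqrt N2" if "0 \<le> t" for t
  proof (rule T.norm_blinfun_bound_domain)
    fix x assume "x \<in> D"
    with key that have "(norm (T t x))\<^sup>2 \<le> (sqrt N2 * norm x)\<^sup>2"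
      using N2 by (simp add: power_mult_distrib)
    then show "norm (T t x) \<le> sqrt N2 * norm x"
      by (rule power2_le_imp_le) (simp add: N2)
  qed (simp add: N2)
  then show ?thesis
    by (rule T.square_integrable_imp_exponentially_stable[where K = K])
      (use key \<epsilon> p in \<open>auto simp: K_def\<close>)
qed

section \<open>The Lyapunov integral of a stable semigroup\<close>

text \<open>For norm bounded families, weak* convergence need only be tested on a set with dense
  span: a functional \<open>u\<close> is replaced by a nearby \<open>v\<close> in the span, with an
  error uniform in \<open>i\<close>.\<close>

lemma tendsto_blinfun_apply_closure_span:
  fixes B :: "('a::real_normed_vector \<Rightarrow>\<^sub>L real) set"
  assumes K: "\<forall>\<^sub>F i in F. norm (X i) \<le> K"
    and B: "\<And>b. b \<in> B \<Longrightarrow> ((\<lambda>i. blinfun_apply b (X i)) \<longlongrightarrow> b Z) F"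
    and u: "u \<in> closure (span B)"
  shows "((\<lambda>i. blinfun_apply u (X i)) \<longlongrightarrow> u Z) F"
proof (rule tendstoI)
  fix e :: real assume e: "0 < e"
  \<comment> \<open>Bounds \<open>norm (X i - Z)\<close> eventually; the summand 1 allows division
    by \<open>c\<close>.\<close>
  define c where "c = \<bar>K\<bar> + norm Z + 1"
  have c: "0 < c" by (simp add: c_def add_nonneg_pos)
  have span: "((\<lambda>i. blinfun_apply v (X i)) \<longlongrightarrow> v Z) F" if "v \<in> span B" for v
    using that
  proof (induction rule: span_induct_alt)
    case base
    show ?case by simp
  next
    case (step k b v)
    then show ?case by (simp add: blinfun.bilinear_simps B tendsto_intros)
  qed
  from u obtain v where v: "v \<in> span B" and uv: "norm (u - v) < e / (2 * c)"
    unfolding closure_approachable using e c by (metis dist_commute dist_norm divide_pos_pos mult_pos_pos zero_less_numeral)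
  have "\<forall>\<^sub>F i in F. dist (v (X i)) (v Z) < e / 2"
    using tendstoD[OF span[OF v], of "e / 2"] e by simp
  with K show "\<forall>\<^sub>F i in F. dist (u (X i)) (u Z) < e"
  proof eventually_elim
    case (elim i)
    have "norm ((u - v) (X i - Z)) \<le> norm (u - v) * norm (X i - Z)" by (rule norm_blinfun)
    also have "\<dots> \<le> e / (2 * c) * c"
    proof (intro mult_mono)
      show "norm (X i - Z) \<le> c"
        using norm_triangle_ineq4[of "X i" Z] elim by (simp add: c_def)
    qed (use uv e c in auto)
    also have "\<dots> = e / 2" using c by simp
    finally have "norm ((u - v) (X i - Z)) \<le> e / 2" .
    moreover have "u (X i) - u Z = (u - v) (X i - Z) + (v (X i) - v Z)"
      by (simp add: blinfun.bilinear_simps)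
    ultimately show ?case
      using elim(2) norm_triangle_ineq[of "(u - v) (X i - Z)" "v (X i) - v Z"]
      by (simp add: dist_norm)
  qed
qed

text \<open>The tail beyond \<open>t\<close> is at most \<open>c * exp (- a * t) / a\<close>. This
  gives convergence of the truncated integrals and, at \<open>t = 0\<close>, the norm bound.\<close>

lemma tendsto_integral_atLeast_exp_bound:
  fixes f :: "real \<Rightarrow> real"
  assumes cont: "continuous_on {0..} f" and a: "0 < a"
    and bound: "\<And>s. 0 \<le> s \<Longrightarrow> \<bar>f s\<bar> \<le> c * exp (- a * s)"
  shows "f integrable_on {0..}"
    and "((\<lambda>t. integral {0..t} f) \<longlongrightarrow> integral {0..} f) at_top"
    and "\<bar>integral {0..} f\<bar> \<le> c / a"
proof -
  have exp: "((\<lambda>s. c * exp (- a * s)) has_integral c * (exp (- a * t) / a)) {t..}" for t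
    by (intro has_integral_mult_right has_integral_exp_minus_to_infinity a)
  have int: "f integrable_on {t..}" if "0 \<le> t" for t
  proof (rule measurable_bounded_by_integrable_imp_integrable_real)
    show "f \<in> borel_measurable (lebesgue_on {t..})"
      using that by (intro continuous_imp_measurable_on_sets_lebesgue
          continuous_on_subset[OF cont]) auto
    show "(\<lambda>s. c * exp (- a * s)) integrable_on {t..}" using exp by blast
  qed (use bound that in auto)
  have tail: "\<bar>integral {t..} f\<bar> \<le> c * (exp (- a * t) / a)" if "0 \<le> t" for t
  proof -
    have "norm (integral {t..} f) \<le> integral {t..} (\<lambda>s. c * exp (- a * s))"
      by (rule integral_norm_bound_integral[OF int]) (use exp bound that in auto)
    then show ?thesis using integral_unique[OF exp] by simp
  qed
  show "f integrable_on {0..}" by (rule int) simp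
  show "\<bar>integral {0..} f\<bar> \<le> c / a" using tail[of 0] by simp
  have split: "integral {0..} f = integral {0..t} f + integral {t..} f" if t: "0 \<le> t" for t
  proof -
    have "(f has_integral (integral {0..t} f + integral {t..} f)) ({0..t} \<union> {t..})"
    proof (rule has_integral_Un)
      show "(f has_integral integral {0..t} f) {0..t}"
        by (intro integrable_integral integrable_continuous_interval continuous_on_subset[OF cont]) auto
      show "(f has_integral integral {t..} f) {t..}"
        by (intro integrable_integral int t)
      have "{0..t} \<inter> {t..} = {t}" using t by auto
      then show "negligible ({0..t} \<inter> {t..})" by simp
    qed
    moreover have "{0..t} \<union> {t..} = {0..}" using t by auto
    ultimately show ?thesis by (simp add: integral_unique)
  qed
  have "((\<lambda>t. integral {0..t} f - integral {0..} f) \<longlongrightarrow> 0) at_top"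
  proof (rule Lim_null_comparison)
    show "\<forall>\<^sub>F t in at_top. norm (integral {0..t} f - integral {0..} f) \<le> c * (exp (- a * t) / a)"
      using eventually_ge_at_top[of 0] by eventually_elim (use split tail in simp)
    show "((\<lambda>t. c * (exp (- a * t) / a)) \<longlongrightarrow> 0) at_top"
      using a by real_asymp
  qed
  then show "((\<lambda>t. integral {0..t} f) \<longlongrightarrow> integral {0..} f) at_top"
    by (simp add: LIM_zero_iff)
qed

section \<open>The inverse of the Lyapunov generator\<close>

locale stable_semigroup = semigroup_generator +
  fixes M \<epsilon> :: real
  assumes eps: "0 < \<epsilon>" and norm_T_le: "0 \<le> t \<Longrightarrow> norm (T t) \<le> M * exp (- \<epsilon> * t)"
begin

lemma continuous_on_quadratic:
  "continuous_on {0..} (\<lambda>s. blinfun_apply (blinfun_apply Q (T s x)) (T s y))"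
  by (intro continuous_intros continuous_on_T)

lemma quadratic_le:
  fixes Q :: "'a \<Rightarrow>\<^sub>L 'a \<Rightarrow>\<^sub>L real"
  assumes s: "0 \<le> s"
  shows "\<bar>Q (T s x) (T s y)\<bar> \<le> M\<^sup>2 * norm Q * norm x * norm y * exp (- (2 * \<epsilon>) * s)"
proof -
  have le: "norm (T s z) \<le> M * exp (- \<epsilon> * s) * norm z" for z
    using norm_T_le[OF s] by (meson mult_right_mono norm_blinfun norm_ge_zero order_trans)
  have "norm (Q (T s x) (T s y)) \<le> norm (Q (T s x)) * norm (T s y)" by (rule norm_blinfun)
  also have "\<dots> \<le> norm Q * norm (T s x) * norm (T s y)"
    by (intro mult_right_mono norm_blinfun) simp
  also have "\<dots> \<le> norm Q * (M * exp (- \<epsilon> * s) * norm x) * (M * exp (- \<epsilon> * s) * norm y)"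
    by (intro mult_mono mult_nonneg_nonneg le order_trans[OF norm_ge_zero le] order_refl) auto
  also have "\<dots> = M\<^sup>2 * norm Q * norm x * norm y * (exp (- \<epsilon> * s))\<^sup>2"
    by (simp add: power2_eq_square)
  also have "(exp (- \<epsilon> * s))\<^sup>2 = exp (- (2 * \<epsilon>) * s)"
    by (simp add: mult.assoc flip: exp_double)
  finally show ?thesis by simp
qed

lemma quadratic_integral:
  fixes Q :: "'a \<Rightarrow>\<^sub>L 'a \<Rightarrow>\<^sub>L real"
  shows "(\<lambda>s. Q (T s x) (T s y)) integrable_on {0..}"
    and "((\<lambda>t. integral {0..t} (\<lambda>s. Q (T s x) (T s y))) \<longlongrightarrow> integral {0..} (\<lambda>s. Q (T s x) (T s y))) at_top"
    and "\<bar>integral {0..} (\<lambda>s. Q (T s x) (T s y))\<bar> \<le> M\<^sup>2 * norm Q * norm x * norm y / (2 * \<epsilon>)"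
  by (rule tendsto_integral_atLeast_exp_bound[OF continuous_on_quadratic _ quadratic_le];
      use eps in simp)+

text \<open>Taken on each pair of vectors, where the integrand is continuous and the integral is an
  ordinary real one. \<open>Blinfun\<close> is meaningful only on bounded linear maps;
  \<open>lyapunov_integral_apply\<close> checks this for both layers through boundedness of the
  bilinear form.\<close>

definition lyapunov_integral :: "('a \<Rightarrow>\<^sub>L 'a \<Rightarrow>\<^sub>L real) \<Rightarrow> 'a \<Rightarrow>\<^sub>L 'a \<Rightarrow>\<^sub>L real" where
  "lyapunov_integral Q =
    Blinfun (\<lambda>x. Blinfun (\<lambda>y. integral {0..} (\<lambda>s. Q (T s x) (T s y))))"

lemma lyapunov_integral_apply:
  "lyapunov_integral Q x y = integral {0..} (\<lambda>s. Q (T s x) (T s y))"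
proof -
  have bound: "\<bar>integral {0..} (\<lambda>s. Q (T s x) (T s y))\<bar> \<le>
      norm x * norm y * (M\<^sup>2 * norm Q / (2 * \<epsilon>))" for x y
    using quadratic_integral(3)[of Q x y] eps by (simp add: mult_ac)
  interpret bb: bounded_bilinear "\<lambda>x y. integral {0..} (\<lambda>s. Q (T s x) (T s y))"
  proof (unfold_locales, goal_cases)
    case 5
    show ?case using bound by (intro exI[of _ "M\<^sup>2 * norm Q / (2 * \<epsilon>)"]) simp
  qed (use eps in \<open>simp_all add: blinfun.bilinear_simps integral_add quadratic_integral(1)\<close>)
  have "lyapunov_integral Q = Blinfun (\<lambda>x. bb.prod_right x)"
    by (simp add: lyapunov_integral_def bb.prod_right_def)
  then show ?thesis
    by (simp add: bounded_linear_Blinfun_apply[OF bb.bounded_linear_prod_right])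
qed

lemma norm_lyapunov_integral: "norm (lyapunov_integral Q) \<le> M\<^sup>2 / (2 * \<epsilon>) * norm Q"
proof (rule norm_blinfun_bound)
  show pos: "0 \<le> M\<^sup>2 / (2 * \<epsilon>) * norm Q" using eps by simp
  fix x
  show "norm (lyapunov_integral Q x) \<le> M\<^sup>2 / (2 * \<epsilon>) * norm Q * norm x"
  proof (rule norm_blinfun_bound)
    show "0 \<le> M\<^sup>2 / (2 * \<epsilon>) * norm Q * norm x" using pos by (rule mult_nonneg_nonneg) simp
    show "norm (lyapunov_integral Q x y) \<le> M\<^sup>2 / (2 * \<epsilon>) * norm Q * norm x * norm y" for y
      using quadratic_integral(3)[of Q x y] eps by (simp add: lyapunov_integral_apply)
  qed
qed

lemma lyapunov_integral_symmetric:
  "Q \<in> symmetric_ops \<Longrightarrow> lyapunov_integral Q \<in> symmetric_ops"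
  by (simp add: symmetric_ops_def lyapunov_integral_apply)

lemma lyapunov_integral_positive:
  "Q \<in> positive_ops \<Longrightarrow> lyapunov_integral Q \<in> positive_ops"
  using lyapunov_integral_symmetric eps
  by (auto simp: positive_ops_def lyapunov_integral_apply intro!: integral_nonneg quadratic_integral(1))

lemma lyapunov_integral_uminus: "lyapunov_integral (- Q) = - lyapunov_integral Q"
  by (intro blinfun_eqI) (simp add: lyapunov_integral_apply blinfun.minus_left)

text \<open>By the semigroup law, \<open>T t\<close> moves the range of integration from
  \<open>{0..}\<close> to \<open>{t..}\<close>. The substitution is made on compact intervals and
  then passed to the limit.\<close>

lemma lyapunov_integral_shift:
  assumes t: "0 \<le> t"
  shows "lyapunov_integral Q (T t x) (T t y) =
    lyapunov_integral Q x y - integral {0..t} (\<lambda>s. Q (T s x) (T s y))"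
proof -
  let ?f = "\<lambda>s. Q (T s x) (T s y)"
  have int: "?f integrable_on {a..b}" if "0 \<le> a" for a b
    by (intro integrable_continuous_interval continuous_on_subset[OF continuous_on_quadratic])
      (use that in auto)
  have "integral {0..u} (\<lambda>s. Q (T s (T t x)) (T s (T t y))) = integral {0..u + t} ?f - integral {0..t} ?f"
    if u: "0 \<le> u" for u
  proof -
    have "integral {0..u} (\<lambda>s. Q (T s (T t x)) (T s (T t y))) = integral {0..u} (?f \<circ> (+) t)"
      by (intro integral_cong) (use t in \<open>simp add: add.commute flip: T_add_apply\<close>)
    also have "\<dots> = integral {t..u + t} ?f"
      by (subst integral_shift_Icc_real) simp
    also have "integral {0..t} ?f + \<dots> = integral {0..u + t} ?f"
      by (rule Henstock_Kurzweil_Integration.integral_combine) (use t u int in auto)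
    finally show ?thesis by simp
  qed
  then have "\<forall>\<^sub>F u in at_top. integral {0..u + t} ?f - integral {0..t} ?f =
      integral {0..u} (\<lambda>s. Q (T s (T t x)) (T s (T t y)))"
    by (intro eventually_mono[OF eventually_ge_at_top[of 0]]) simp
  moreover have "filterlim (\<lambda>u. u + t) at_top at_top"
    by (subst add.commute) (rule filterlim_tendsto_add_at_top[OF tendsto_const filterlim_ident])
  then have "((\<lambda>u. integral {0..u + t} ?f) \<longlongrightarrow> integral {0..} ?f) at_top"
    by (rule filterlim_compose[OF quadratic_integral(2)[of Q x y]])
  then have "((\<lambda>u. integral {0..u + t} ?f - integral {0..t} ?f) \<longlongrightarrow>
      integral {0..} ?f - integral {0..t} ?f) at_top"
    by (intro tendsto_intros)
  ultimately have "((\<lambda>u. integral {0..u} (\<lambda>s. Q (T s (T t x)) (T s (T t y)))) \<longlongrightarrow>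
      integral {0..} ?f - integral {0..t} ?f) at_top"
    by (rule Lim_transform_eventually[rotated])
  from tendsto_unique[OF trivial_limit_at_top_linorder quadratic_integral(2) this]
  show ?thesis by (simp add: lyapunov_integral_apply)
qed

text \<open>By the shift, the quotient is minus the mean over \<open>{0..t}\<close> of the form of
  \<open>Q\<close> along orbits, which tends to \<open>- Q\<close> on each pair of vectors. The
  bound \<open>M\<^sup>2 * norm Q\<close> for the quotients extends this to all test
  functionals.\<close>

lemma lyapunov_limit_integral:
  assumes Q: "Q \<in> symmetric_ops"
  shows "lyapunov_limit T (lyapunov_integral Q) (- Q)"
proof -
  define R where "R = lyapunov_integral Q"
  define X where "X t = (1 / t) *\<^sub>R (lyapunov_semigroup T t R - R)" for t
  have X: "X t x y = - (1 / t * integral {0..t} (\<lambda>s. Q (T s x) (T s y)))" if "0 < t" for t x y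
    using that by (simp add: X_def R_def blinfun.bilinear_simps lyapunov_semigroup_apply
        lyapunov_integral_shift)
  have lim: "((\<lambda>t. X t x y) \<longlongrightarrow> blinfun_apply (blinfun_apply (- Q) x) y) (at_right 0)" for x y
  proof -
    have "((\<lambda>t. 1 / t * integral {0..t} (\<lambda>s. Q (T s x) (T s y))) \<longlongrightarrow> Q x y) (at_right 0)"
      using integral_has_vector_derivative_atLeast[OF continuous_on_quadratic order_refl, of Q x y]
      by (simp add: has_vector_derivative_iff_quotient at_within_Ici_at_right T_zero)
    then have "((\<lambda>t. - (1 / t * integral {0..t} (\<lambda>s. Q (T s x) (T s y)))) \<longlongrightarrow> blinfun_apply (blinfun_apply (- Q) x) y) (at_right 0)"
      by (simp add: blinfun.minus_left tendsto_minus)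
    then show ?thesis
      by (rule Lim_transform_eventually)
        (auto simp: X intro!: eventually_mono[OF eventually_at_right_less[of 0]])
  qed
  have "norm (X t) \<le> M\<^sup>2 * norm Q" if t: "0 < t" for t
  proof (rule norm_blinfun_bound)
    fix x :: 'a
    show "norm (X t x) \<le> M\<^sup>2 * norm Q * norm x"
    proof (rule norm_blinfun_bound)
      fix y :: 'a
      let ?c = "M\<^sup>2 * norm Q * norm x * norm y"
      have "norm (integral {0..t} (\<lambda>s. Q (T s x) (T s y))) \<le> ?c * (t - 0)"
      proof (rule integral_bound)
        show "continuous_on {0..t} (\<lambda>s. Q (T s x) (T s y))"
          by (rule continuous_on_subset[OF continuous_on_quadratic]) auto
        fix s assume s: "s \<in> {0..t}"
        have "\<bar>Q (T s x) (T s y)\<bar> \<le> ?c * exp (- (2 * \<epsilon>) * s)"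
          using quadratic_le s by simp
        also have "\<dots> \<le> ?c * 1" using s eps by (intro mult_left_mono) auto
        finally show "norm (Q (T s x) (T s y)) \<le> ?c" by simp
      qed (use t in simp)
      then show "norm (X t x y) \<le> ?c" using t by (simp add: X abs_mult field_simps)
    qed simp
  qed simp
  then have "\<forall>\<^sub>F t in at_right 0. norm (X t) \<le> M\<^sup>2 * norm Q"
    by (auto intro!: eventually_mono[OF eventually_at_right_less[of 0]])
  then have "((\<lambda>t. blinfun_apply u (X t)) \<longlongrightarrow> u (- Q)) (at_right 0)" if "u \<in> symmetric_tensors" for u
    by (rule tendsto_blinfun_apply_closure_span)
      (use that lim in \<open>auto simp: symmetric_tensors_def blinfun.add_left intro!: tendsto_add\<close>)
  moreover have "X t \<in> symmetric_ops" for t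
    using lyapunov_integral_symmetric[OF Q]
    by (simp add: X_def R_def symmetric_ops_def blinfun.bilinear_simps lyapunov_semigroup_apply)
  moreover have "- Q \<in> symmetric_ops"
    using Q by (simp add: symmetric_ops_def blinfun.minus_left)
  ultimately show ?thesis
    unfolding lyapunov_limit_def limitin_weak_star_iff X_def R_def by simp
qed

text \<open>Gives injectivity of the generator. The difference \<open>E\<close> solves the
  homogeneous equation, so \<open>E (T t x) (T t y)\<close> is constant in \<open>t\<close> for
  \<open>x\<close>, \<open>y\<close> in \<open>D\<close>, while stability sends it to 0; density in
  both arguments yields \<open>E = 0\<close>.\<close>

lemma lyapunov_limit_imp_eq_integral:
  assumes P: "P \<in> symmetric_ops" and lim: "lyapunov_limit T P Q"
  shows "P = lyapunov_integral (- Q)"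
proof -
  have Q: "- Q \<in> symmetric_ops"
    using lim by (auto simp: lyapunov_limit_def limitin_weak_star_iff symmetric_ops_def blinfun.minus_left)
  define E where "E = P - lyapunov_integral (- Q)"
  have E0: "E x (A y) + E (A x) y = 0" if "x \<in> D" "y \<in> D" for x y
    using lyapunov_limit_on_domain[OF P lim that]
      lyapunov_limit_on_domain[OF lyapunov_integral_symmetric[OF Q] lyapunov_limit_integral[OF Q] that]
    by (simp add: E_def blinfun.bilinear_simps)
  have "E x y = 0" if x: "x \<in> D" and y: "y \<in> D" for x y
  proof -
    have const: "E (T t x) (T t y) = E x y" if t: "0 \<le> t" for t
    proof -
      have deriv: "((\<lambda>r. E (T r x) (T r y)) has_vector_derivative 0) (at s within {0..})" if s: "0 \<le> s" for s
        using has_vector_derivative_quadratic[OF x y s, of E] E0[OF T_domain(1)[OF x s] T_domain(1)[OF y s]]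
        by simp
      have "((\<lambda>_. 0 :: real) has_integral (E (T t x) (T t y) - E (T 0 x) (T 0 y))) {0..t}"
        using t by (intro fundamental_theorem_of_calculus)
          (auto intro: has_vector_derivative_within_subset[OF deriv])
      then show ?thesis by (simp add: T_zero)
    qed
    have "((\<lambda>t. E (T t x) (T t y)) \<longlongrightarrow> 0) at_top"
    proof (rule Lim_null_comparison)
      show "\<forall>\<^sub>F t in at_top. norm (E (T t x) (T t y)) \<le>
          M\<^sup>2 * norm E * norm x * norm y * exp (- (2 * \<epsilon>) * t)"
        using eventually_ge_at_top[of 0] by eventually_elim (use quadratic_le[of _ E x y] in simp)
      show "((\<lambda>t. M\<^sup>2 * norm E * norm x * norm y * exp (- (2 * \<epsilon>) * t)) \<longlongrightarrow> 0) at_top"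
        using eps by real_asymp
    qed
    moreover have "((\<lambda>t. E (T t x) (T t y)) \<longlongrightarrow> E x y) at_top"
      by (rule tendsto_eventually) (auto intro!: eventually_mono[OF eventually_ge_at_top[of 0]] const)
    ultimately show ?thesis
      using tendsto_unique[OF trivial_limit_at_top_linorder] by blast
  qed
  then have "E x = 0" if "x \<in> D" for x
    using that by (intro blinfun_eqI_domain) simp
  then have "E = 0" by (intro blinfun_eqI_domain) simp
  then show ?thesis by (simp add: E_def)
qed

text \<open>The integral of \<open>- Q\<close> is a right inverse by
  \<open>lyapunov_limit_integral\<close> and a left inverse by
  \<open>lyapunov_limit_imp_eq_integral\<close>.\<close>

lemma lyapunov_inverse:
  shows "bij_betw (lyapunov_generator T) (lyapunov_domain T) symmetric_ops"
    and "Q \<in> symmetric_ops \<Longrightarrow>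
      the_inv_into (lyapunov_domain T) (lyapunov_generator T) Q = - lyapunov_integral Q"
proof -
  have gen: "lyapunov_limit T P (lyapunov_generator T P)" if "P \<in> lyapunov_domain T" for P
    using that lyapunov_generator_eq unfolding lyapunov_domain_def by blast
  have neg: "- Q \<in> symmetric_ops" if "Q \<in> symmetric_ops" for Q :: "'a \<Rightarrow>\<^sub>L 'a \<Rightarrow>\<^sub>L real"
    using that by (simp add: symmetric_ops_def blinfun.minus_left)
  have dom: "lyapunov_integral (- Q) \<in> lyapunov_domain T"
    and right: "lyapunov_generator T (lyapunov_integral (- Q)) = Q"
    if Q: "Q \<in> symmetric_ops" for Q
  proof -
    have lim: "lyapunov_limit T (lyapunov_integral (- Q)) Q"
      using lyapunov_limit_integral[OF neg[OF Q]] by simp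
    then show dom: "lyapunov_integral (- Q) \<in> lyapunov_domain T"
      unfolding lyapunov_domain_def using lyapunov_integral_symmetric[OF neg[OF Q]] by blast
    show "lyapunov_generator T (lyapunov_integral (- Q)) = Q"
      using lim by (rule lyapunov_generator_eq)
  qed
  show bij: "bij_betw (lyapunov_generator T) (lyapunov_domain T) symmetric_ops"
  proof (rule bij_betwI[where g = "\<lambda>Q. lyapunov_integral (- Q)"])
    show "lyapunov_generator T \<in> lyapunov_domain T \<rightarrow> symmetric_ops"
      using gen unfolding lyapunov_limit_def limitin_weak_star_iff by blast
    show "lyapunov_integral (- lyapunov_generator T P) = P" if "P \<in> lyapunov_domain T" for P
      using lyapunov_limit_imp_eq_integral[OF _ gen[OF that]] that
      by (simp add: lyapunov_domain_def)
  qed (use dom right in auto)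
  show "the_inv_into (lyapunov_domain T) (lyapunov_generator T) Q = - lyapunov_integral Q"
    if "Q \<in> symmetric_ops"
    using the_inv_into_f_eq[OF bij_betw_imp_inj_on[OF bij] right[OF that] dom[OF that]]
    by (simp add: lyapunov_integral_uminus)
qed

end

section \<open>The cycle of implications from (i) to (ii) to (iii) and back\<close>

theorem theorem1:
  fixes T :: "real \<Rightarrow> 'x::banach \<Rightarrow>\<^sub>L 'x"
    and A :: "'x \<Rightarrow> 'x" and D :: "'x set"
    and C :: "'x \<Rightarrow>\<^sub>L 'v::{real_inner,complete_space}"
  assumes "generates D A T"
    and "exponentially_detectable C D A"
  shows
    "((\<exists>P\<in>positive_ops. P ` D \<subseteq> adjoint_domain D A \<and>
         (\<forall>x\<in>D. banach_adjoint D A (P x) + P (A x) = - hilbert_adjoint C (C x)))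
       \<longleftrightarrow> exponentially_stable T) \<and>
     (exponentially_stable T
       \<longleftrightarrow> bounded_inverse_on symmetric_ops (lyapunov_domain T) (lyapunov_generator T) \<and>
           nonneg_map (\<lambda>Q. - the_inv_into (lyapunov_domain T) (lyapunov_generator T) Q))"
  (is "(?i \<longleftrightarrow> ?ii) \<and> (?ii \<longleftrightarrow> ?iii)")
proof -
  interpret semigroup_generator D A T by unfold_locales (rule assms)
  define CC where "CC = hilbert_adjoint C o\<^sub>L C"
  have CC: "CC x y = C x \<bullet> C y" for x y
    by (simp add: CC_def hilbert_adjoint_apply)
  have "CC \<in> positive_ops"
    by (simp add: positive_ops_def symmetric_ops_def CC inner_commute)
  \<comment> \<open>Condition (i) in terms of forms, the shape in which it is used for (ii) and
    obtained from (iii).\<close>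
  have i_iff: "P ` D \<subseteq> adjoint_domain D A \<and>
      (\<forall>x\<in>D. banach_adjoint D A (P x) + P (A x) = - hilbert_adjoint C (C x)) \<longleftrightarrow>
      (\<forall>x\<in>D. \<forall>y\<in>D. P x (A y) + P (A x) y = - (C x \<bullet> C y))" for P :: "'x \<Rightarrow>\<^sub>L 'x \<Rightarrow>\<^sub>L real"
    using lyapunov_equation_iff[of P "- CC"]
    by (simp add: blinfun.minus_left CC) (simp add: CC_def)
  have "?ii" if "?i"
    using that lyapunov_equation_imp_exponentially_stable[OF assms] unfolding i_iff by blast
  moreover have "?iii" if ii: "?ii"
  proof -
    obtain M \<epsilon> where "0 < \<epsilon>" "\<And>t. 0 \<le> t \<Longrightarrow> norm (T t) \<le> M * exp (- \<epsilon> * t)"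
      using ii unfolding exponentially_stable_def by blast
    then interpret stable_semigroup D A T M \<epsilon> by unfold_locales auto
    have "norm (the_inv_into (lyapunov_domain T) (lyapunov_generator T) Q) \<le> M\<^sup>2 / (2 * \<epsilon>) * norm Q"
      if "Q \<in> symmetric_ops" for Q
      using norm_lyapunov_integral[of Q] lyapunov_inverse(2)[OF that] by simp
    moreover have "- the_inv_into (lyapunov_domain T) (lyapunov_generator T) Q \<in> positive_ops"
      if "Q \<in> positive_ops" for Q
      using lyapunov_integral_positive[OF that] lyapunov_inverse(2)[of Q] that
      by (simp add: positive_ops_def)
    ultimately show ?thesis
      unfolding bounded_inverse_on_def nonneg_map_def using lyapunov_inverse(1) by blast
  qed
  moreover have "?i" if iii: "?iii"
  proof -
    \<comment> \<open>The solution is \<open>- R\<close>: the sign turns the right-hand side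
      \<open>CC\<close> into \<open>- CC\<close>, and its positivity is the second half of (iii)
      applied to \<open>CC\<close>.\<close>
    define R where "R = the_inv_into (lyapunov_domain T) (lyapunov_generator T) CC"
    have bij: "bij_betw (lyapunov_generator T) (lyapunov_domain T) symmetric_ops"
      using iii by (simp add: bounded_inverse_on_def)
    have CC_sym: "CC \<in> symmetric_ops" using \<open>CC \<in> positive_ops\<close> by (simp add: positive_ops_def)
    have R: "R \<in> lyapunov_domain T" "lyapunov_generator T R = CC"
      unfolding R_def
      using f_the_inv_into_f_bij_betw[OF bij, of CC] CC_sym bij_betwE[OF bij_betw_the_inv_into[OF bij]]
      by auto
    then obtain Q where R_sym: "R \<in> symmetric_ops" and Q: "lyapunov_limit T R Q"
      unfolding lyapunov_domain_def by blast
    with R(2) have "Q = CC" using lyapunov_generator_eq by blast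
    then have Rxy: "R x (A y) + R (A x) y = C x \<bullet> C y" if "x \<in> D" "y \<in> D" for x y
      using lyapunov_limit_on_domain[OF R_sym Q that] that by (simp add: CC)
    have "\<forall>x\<in>D. \<forall>y\<in>D. blinfun_apply (blinfun_apply (- R) x) (A y) + blinfun_apply (blinfun_apply (- R) (A x)) y = - (C x \<bullet> C y)"
      by (simp add: blinfun.minus_left flip: Rxy)
    moreover have "- R \<in> positive_ops"
      using iii \<open>CC \<in> positive_ops\<close> unfolding nonneg_map_def R_def by blast
    ultimately show ?thesis unfolding i_iff by blast
  qed
  ultimately show ?thesis by blast
qed

end
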